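(* For every $n\ge1$ the following equidistributions hold: (1) $LB(14/2/3,1/24/3)\sim RS(14/2/3,1/24/3)\sim LB(14/2/3,13/2/4)\sim RS(14/2/3,13/2/4)$; (2) $LS(14/2/3,1/24/3)\sim RB(14/2/3,13/2/4)$; (3) $RB(14/2/3,1/24/3)\sim LS(14/2/3,13/2/4)$. Here, for $\mathrm{st}\in\{ls,lb,rs,rb\}$ with corresponding capital letters $ST\in\{LS,LB,RS,RB\}$, $ST(\pi_1,\pi_2)\sim ST'(\pi_1',\pi_2')$ means that for every integer $k$, the number of $w\in R_n(\pi_1,\pi_2)$ with $\mathrm{st}(w)=k$ equals the number of $w\in R_n(\pi_1',\pi_2')$ with $\mathrm{st}'(w)=k$.
   Context: A set partition $\sigma$ of $[n]=\{1,\dots,n\}$ is written $\sigma=B_1/B_2/\dots/B_m$ with blocks ordered so that $\min B_1<\dots<\min B_m$. For $A\subseteq[n]$, the subpartition $A\cap\sigma$ is the set partition of $A$ formed by the nonempty sets $A\cap B_i$; it is standardized by replacing its smallest element by $1$, the next smallest by $2$, and so on. $\sigma$ contains a pattern $\pi$ (a set partition of some $[k]$) if some subpartition of $\sigma$ standardizes to $\pi$; otherwise $\sigma$ avoids $\pi$. To $\sigma=B_1/\dots/B_m$ corresponds the word (restricted growth function) $w(\sigma)=w_1\cdots w_n$ with $w_i=j$ if $i\in B_j$. $R_n(\pi_1,\pi_2)$ is the set of words $w(\sigma)$ for set partitions $\sigma$ of $[n]$ avoiding both $\pi_1$ and $\pi_2$. Wachs and White statistics: for a word $w=w_1\cdots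 w_n$ and position $i$, let (counting distinct letter values) $rs_i(w)=|\{w_j: j>i,\ w_j<w_i\}|$, $ls_i(w)=|\{w_j: j<i,\ w_j<w_i\}|$, $lb_i(w)=|\{w_j: j<i,\ w_j>w_i\}|$, $rb_i(w)=|\{w_j: j>i,\ w_j>w_i\}|$; and $rs(w)=\sum_i rs_i(w)$, $ls(w)=\sum_i ls_i(w)$, $lb(w)=\sum_i lb_i(w)$, $rb(w)=\sum_i rb_i(w)$. Patterns: slashes separate blocks: $14/2/3$ is the set partition $\{1,4\},\{2\},\{3\}$ of $[4]$, $1/24/3$ is $\{1\},\{2,4\},\{3\}$, and $13/2/4$ is $\{1,3\},\{2\},\{4\}$. *)

theory Defs
  imports Complex_Main "HOL-Library.Disjoint_Sets"
begin

text \<open>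
  Set partitions of \<open>[n]\<close> are the \<open>P :: nat set set\<close> with
  \<^term>\<open>partition_on {1..n} P\<close>.
\<close>

definition subpartition :: "nat set \<Rightarrow> nat set set \<Rightarrow> nat set set" where
  "subpartition A P = (\<lambda>B. A \<inter> B) ` P - {{}}"

text \<open>
  The element \<open>x\<close> of the ground set \<open>\<Union>P\<close> is replaced by its rank there, so the smallest
  element becomes \<open>1\<close>, the next smallest \<open>2\<close>, and so on.
\<close>

definition standardize :: "nat set set \<Rightarrow> nat set set" where
  "standardize P = (\<lambda>B. (\<lambda>x. card {y \<in> \<Union>P. y \<le> x}) ` B) ` P"

definition contains_pattern :: "nat set set \<Rightarrow> nat set set \<Rightarrow> bool" where
  "contains_pattern P pat \<longleftrightarrow> (\<exists>A \<subseteq> \<Union>P. standardize (subpartition A P) = pat)"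

definition avoids :: "nat set set \<Rightarrow> nat set set \<Rightarrow> bool" where
  "avoids P pat \<longleftrightarrow> \<not> contains_pattern P pat"

definition block_of :: "nat set set \<Rightarrow> nat \<Rightarrow> nat set" where
  "block_of P i = (THE B. B \<in> P \<and> i \<in> B)"

text \<open>
  The position (starting from \<open>1\<close>) of the block \<open>B\<close> when the blocks are listed
  by increasing minima.
\<close>

definition block_index :: "nat set set \<Rightarrow> nat set \<Rightarrow> nat" where
  "block_index P B = card {C \<in> P. Min C \<le> Min B}"

text \<open>
  Words are lists; the letter \<open>w\<^sub>i\<close>, \<open>1 \<le> i \<le> n\<close>, is the list entry at index \<open>i - 1\<close>.
\<close>

definition rgf :: "nat \<Rightarrow> nat set set \<Rightarrow> nat list" where
  "rgf n P = map (\<lambda>i. block_index P (block_of P i)) [1..<n + 1]"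

definition R :: "nat \<Rightarrow> nat set set \<Rightarrow> nat set set \<Rightarrow> nat list set" where
  "R n pat1 pat2 = rgf n ` {P. partition_on {1..n} P \<and> avoids P pat1 \<and> avoids P pat2}"

text \<open>
  The sets below collect letter values, not positions, so repeated letters count once.
\<close>

definition rs_at :: "nat list \<Rightarrow> nat \<Rightarrow> nat" where
  "rs_at w i = card {w ! j |j. i < j \<and> j < length w \<and> w ! j < w ! i}"

definition ls_at :: "nat list \<Rightarrow> nat \<Rightarrow> nat" where
  "ls_at w i = card {w ! j |j. j < i \<and> w ! j < w ! i}"

definition lb_at :: "nat list \<Rightarrow> nat \<Rightarrow> nat" where
  "lb_at w i = card {w ! j |j. j < i \<and> w ! j > w ! i}"

definition rb_at :: "nat list \<Rightarrow> nat \<Rightarrow> nat" where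
  "rb_at w i = card {w ! j |j. i < j \<and> j < length w \<and> w ! j > w ! i}"

definition rs :: "nat list \<Rightarrow> nat" where "rs w = (\<Sum>i<length w. rs_at w i)"
definition ls :: "nat list \<Rightarrow> nat" where "ls w = (\<Sum>i<length w. ls_at w i)"
definition lb :: "nat list \<Rightarrow> nat" where "lb w = (\<Sum>i<length w. lb_at w i)"
definition rb :: "nat list \<Rightarrow> nat" where "rb w = (\<Sum>i<length w. rb_at w i)"

definition equidistributed ::
  "(nat list \<Rightarrow> nat) \<Rightarrow> nat list set \<Rightarrow> (nat list \<Rightarrow> nat) \<Rightarrow> nat list set \<Rightarrow> bool" where
  "equidistributed st W st' W' \<longleftrightarrow>
     (\<forall>k::int. card {w \<in> W. int (st w) = k} = card {w \<in> W'. int (st' w) = k})"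

definition pat_14_2_3 :: "nat set set" where "pat_14_2_3 = {{1, 4}, {2}, {3}}"
definition pat_1_24_3 :: "nat set set" where "pat_1_24_3 = {{1}, {2, 4}, {3}}"
definition pat_13_2_4 :: "nat set set" where "pat_13_2_4 = {{1, 3}, {2}, {4}}"

end

theory Submission
  imports Defs
begin

text \<open>
  A restricted growth function \<open>w\<close> with maximal letter \<open>m\<close> avoids 14/2/3 and 1/24/3 iff its only
  inversions are 2 before 1, and it avoids 14/2/3 and 13/2/4 iff its only inversions are \<open>m\<close> before
  \<open>m - 1\<close>. Hence such words are the concatenations \<open>v (t + 2)\<close>, respectively \<open>t (v + r)\<close>, where \<open>v\<close>
  is a word on the letters 1, 2 starting with 1 and \<open>t\<close> is a weakly increasing word with letters
  \<open>1, \<dots>, r\<close>. All four statistics are additive over these concatenations, up to a term that depends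
  only on the lengths and the numbers of letters, and the inversion statistics \<open>lb\<close>, \<open>rs\<close> vanish
  on \<open>t\<close>.

  It remains to permute the words \<open>v\<close> and \<open>t\<close>. Reversing and complementing \<open>t\<close> exchanges \<open>ls\<close> and
  \<open>rb\<close>. On \<open>v\<close>, exchanging 1 and 2 in the part strictly between the initial 1 and the last 2
  exchanges \<open>ls\<close> and \<open>rb\<close>; exchanging them strictly between the first 2 and the last 1
  exchanges \<open>lb\<close> and \<open>rs\<close>.
\<close>

subsection \<open>Pattern containment in words\<close>

text \<open>Partitions are handled through their equivalence relation, which compares directly with
  equality of letters in a word.\<close>

definition same_block :: "'a set set \<Rightarrow> 'a \<Rightarrow> 'a \<Rightarrow> bool" where
  "same_block P x y \<longleftrightarrow> (\<exists>B\<in>P. x \<in> B \<and> y \<in> B)"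

text \<open>A partition is the quotient of its ground set by \<open>same_block\<close>, so this
  relation determines it. Outside \<open>A\<close> the relation is false for both
  partitions.\<close>

lemma partition_on_eqI:
  assumes P: "partition_on A P" and Q: "partition_on A Q"
    and eq: "\<And>x y. x \<in> A \<Longrightarrow> y \<in> A \<Longrightarrow> same_block P x y \<longleftrightarrow> same_block Q x y"
  shows "P = Q"
proof -
  have "same_block P x y \<longleftrightarrow> same_block Q x y" for x y
  proof (cases "x \<in> A \<and> y \<in> A")
    case False
    then have "\<not> same_block P x y" "\<not> same_block Q x y"
      unfolding same_block_def using partition_onD1[OF P] partition_onD1[OF Q] by blast+
    then show ?thesis by simp
  qed (simp add: eq)
  then have "{(x, y). \<exists>p\<in>P. x \<in> p \<and> y \<in> p} = {(x, y). \<exists>p\<in>Q. x \<in> p \<and> y \<in> p}"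
    by (simp add: same_block_def)
  then have "A // {(x, y). \<exists>p\<in>P. x \<in> p \<and> y \<in> p} = A // {(x, y). \<exists>p\<in>Q. x \<in> p \<and> y \<in> p}"
    by (rule arg_cong)
  then show ?thesis
    unfolding partition_on_eq_quotient[OF P] partition_on_eq_quotient[OF Q] .
qed

lemma same_block_image:
  assumes "inj_on f (\<Union>P)" "x \<in> \<Union>P" "y \<in> \<Union>P"
  shows "same_block ((`) f ` P) (f x) (f y) \<longleftrightarrow> same_block P x y"
proof -
  have "f z \<in> f ` B \<longleftrightarrow> z \<in> B" if "B \<in> P" "z \<in> \<Union>P" for z B
    using that by (intro inj_on_image_mem_iff[OF assms(1)]) auto
  then show ?thesis
    using assms unfolding same_block_def by auto
qed

lemma partition_on_subpartition:
  "partition_on N P \<Longrightarrow> A \<subseteq> N \<Longrightarrow> partition_on A (subpartition A P)"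
  using partition_on_restrict[of N P A] by (simp add: subpartition_def Int_absorb2)

lemma same_block_subpartition:
  "x \<in> A \<Longrightarrow> y \<in> A \<Longrightarrow> same_block (subpartition A P) x y \<longleftrightarrow> same_block P x y"
  by (auto simp: same_block_def subpartition_def)

section \<open>Standardization as relabelling by ranks\<close>

definition rank :: "nat set \<Rightarrow> nat \<Rightarrow> nat" where
  "rank A x = card {y \<in> A. y \<le> x}"

lemma rank_less: "finite A \<Longrightarrow> x \<in> A \<Longrightarrow> y \<in> A \<Longrightarrow> x < y \<Longrightarrow> rank A x < rank A y"
  unfolding rank_def by (rule psubset_card_mono) (auto simp: psubset_eq set_eq_iff intro: exI[of _ y])

text \<open>Ranks increase strictly, hence are injective, and they lie in an interval with as many
  elements as \<open>A\<close>.\<close>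

lemma rank_bij_betw:
  assumes "finite A"
  shows "bij_betw (rank A) A {1..card A}"
proof -
  have inj: "inj_on (rank A) A"
    using rank_less[OF assms] by (metis inj_onI less_irrefl linorder_neqE_nat)
  have "rank A ` A \<subseteq> {1..card A}"
  proof clarify
    fix x assume "x \<in> A"
    then have "{x} \<subseteq> {y \<in> A. y \<le> x}" by auto
    then have "card {x} \<le> rank A x"
      unfolding rank_def by (intro card_mono) (use assms in auto)
    moreover have "rank A x \<le> card A"
      unfolding rank_def by (intro card_mono) (use assms in auto)
    ultimately show "rank A x \<in> {1..card A}" by simp
  qed
  then have "rank A ` A = {1..card A}"
    by (intro card_subset_eq) (simp_all add: card_image[OF inj])
  then show ?thesis using inj by (simp add: bij_betw_def)
qed

lemma standardize_alt:
  "partition_on A P \<Longrightarrow> standardize P = (`) (rank A) ` P"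
  unfolding standardize_def rank_def by (simp add: partition_onD1[symmetric])

lemma partition_on_standardize:
  assumes "finite A" "partition_on A P"
  shows "partition_on {1..card A} (standardize P)"
proof -
  note b = rank_bij_betw[OF assms(1)]
  have "partition_on (rank A ` A) ((`) (rank A) ` P - {{}})"
    using b assms(2) by (intro partition_on_inj_image) (auto simp: bij_betw_def)
  moreover have "{} \<notin> (`) (rank A) ` P"
    using partition_onD3[OF assms(2)] by auto
  ultimately show ?thesis
    using b by (simp add: standardize_alt[OF assms(2)] bij_betw_def)
qed

lemma same_block_standardize:
  assumes "finite A" "partition_on A P" "x \<in> A" "y \<in> A"
  shows "same_block (standardize P) (rank A x) (rank A y) \<longleftrightarrow> same_block P x y"
  unfolding standardize_alt[OF assms(2)]
  using rank_bij_betw[OF assms(1)] assms(3,4) partition_onD1[OF assms(2)]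
  by (intro same_block_image) (auto simp: bij_betw_def)

text \<open>The elements of the image that are at most \<open>f x\<close> are exactly the images of
  \<open>1, ..., x\<close>, so ranking inverts an increasing enumeration.\<close>

lemma rank_image_strict_mono:
  assumes "strict_mono_on {1..k} f" "x \<in> {1..k}"
  shows "rank (f ` {1..k}) (f x) = x"
proof -
  have "{y \<in> f ` {1..k}. y \<le> f x} = f ` {1..x}"
    using assms by (auto simp: strict_mono_on_less_eq)
  moreover have "inj_on f {1..x}"
    using strict_mono_on_imp_inj_on[OF assms(1)] by (rule inj_on_subset) (use assms(2) in auto)
  ultimately show ?thesis
    by (simp add: rank_def card_image)
qed

text \<open>An occurrence \<open>A\<close> and its increasing enumeration \<open>f\<close> determine
  each other: \<open>f\<close> inverts \<open>rank A\<close>, and \<open>A\<close> is the image of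
  \<open>f\<close>. This removes standardization from the notion of containment.\<close>

lemma contains_pattern_iff:
  assumes P: "partition_on {1..n} P" and Q: "partition_on {1..k} Q"
  shows "contains_pattern P Q \<longleftrightarrow>
    (\<exists>f. strict_mono_on {1..k} f \<and> f ` {1..k} \<subseteq> {1..n} \<and>
      (\<forall>x\<in>{1..k}. \<forall>y\<in>{1..k}. same_block P (f x) (f y) \<longleftrightarrow> same_block Q x y))"
    (is "_ \<longleftrightarrow> ?rhs")
proof
  assume "contains_pattern P Q"
  then obtain A where A: "A \<subseteq> {1..n}" and eq: "standardize (subpartition A P) = Q"
    using partition_onD1[OF P] by (auto simp: contains_pattern_def)
  have fin: "finite A" using A finite_subset by blast
  note S = partition_on_subpartition[OF P A]
  have "{1..card A} = {1..k}"
    using partition_on_standardize[OF fin S] Q eq by (metis partition_onD1)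
  then have b: "bij_betw (rank A) A {1..k}"
    using rank_bij_betw[OF fin] by metis
  define f where "f = inv_into A (rank A)"
  have f: "f x \<in> A" "rank A (f x) = x" if "x \<in> {1..k}" for x
    using that b unfolding f_def bij_betw_def
    by (metis inv_into_into, metis f_inv_into_f)
  have "strict_mono_on {1..k} f"
  proof (rule strict_mono_onI)
    fix x y assume xy: "x \<in> {1..k}" "y \<in> {1..k}" "x < y"
    show "f x < f y"
    proof (rule ccontr)
      assume "\<not> f x < f y"
      then have "rank A (f y) \<le> rank A (f x)"
        using rank_less[OF fin, of "f y" "f x"] f xy by (cases "f x = f y") auto
      then show False using f xy by simp
    qed
  qed
  moreover have "same_block P (f x) (f y) \<longleftrightarrow> same_block Q x y"
    if "x \<in> {1..k}" "y \<in> {1..k}" for x y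
    using same_block_standardize[OF fin S, of "f x" "f y"] f that eq
    by (simp add: same_block_subpartition)
  moreover have "f ` {1..k} \<subseteq> {1..n}" using f(1) A by blast
  ultimately show ?rhs by blast
next
  assume ?rhs
  then obtain f where mono: "strict_mono_on {1..k} f" and sub: "f ` {1..k} \<subseteq> {1..n}"
    and eq: "\<forall>x\<in>{1..k}. \<forall>y\<in>{1..k}. same_block P (f x) (f y) \<longleftrightarrow> same_block Q x y"
    by (elim exE conjE)
  let ?A = "f ` {1..k}"
  have card: "card ?A = k"
    using strict_mono_on_imp_inj_on[OF mono] by (simp add: card_image)
  note S = partition_on_subpartition[OF P sub]
  \<comment> \<open>Both sides are partitions of \<open>{1..k}\<close>, so comparing their block
    relations suffices; ranks in the image of \<open>f\<close> undo \<open>f\<close>.\<close>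
  have "standardize (subpartition ?A P) = Q"
  proof (rule partition_on_eqI[OF _ Q])
    show "partition_on {1..k} (standardize (subpartition ?A P))"
      using partition_on_standardize[OF _ S] card by simp
    fix x y assume xy: "x \<in> {1..k}" "y \<in> {1..k}"
    note r = rank_image_strict_mono[OF mono xy(1)] rank_image_strict_mono[OF mono xy(2)]
    have "f x \<in> ?A" "f y \<in> ?A" using xy by simp_all
    then have "same_block (standardize (subpartition ?A P)) (rank ?A (f x)) (rank ?A (f y)) \<longleftrightarrow>
        same_block P (f x) (f y)"
      using same_block_standardize[OF _ S] by (simp add: same_block_subpartition)
    then show "same_block (standardize (subpartition ?A P)) x y \<longleftrightarrow> same_block Q x y"
      unfolding r using eq xy by simp
  qed
  then show "contains_pattern P Q"
    using sub partition_onD1[OF P] unfolding contains_pattern_def by auto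
qed

text \<open>Only equalities between letters are compared, not their order: a set partition pattern
  records nothing but membership in common blocks.\<close>

definition word_contains :: "nat list \<Rightarrow> nat list \<Rightarrow> bool" where
  "word_contains w u \<longleftrightarrow>
    (\<exists>f. strict_mono_on {..<length u} f \<and> f ` {..<length u} \<subseteq> {..<length w} \<and>
      (\<forall>x<length u. \<forall>y<length u. w ! f x = w ! f y \<longleftrightarrow> u ! x = u ! y))"

definition represents :: "nat list \<Rightarrow> nat set set \<Rightarrow> bool" where
  "represents w P \<longleftrightarrow> partition_on {1..length w} P \<and>
    (\<forall>i<length w. \<forall>j<length w. same_block P (Suc i) (Suc j) \<longleftrightarrow> w ! i = w ! j)"

text \<open>Both sides ask for an increasing embedding that preserves and reflects one relation.
  They differ by the shift between elements, counted from 1, and list positions, counted from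
  0.\<close>

lemma contains_pattern_represents:
  assumes "represents w P" "represents u Q"
  shows "contains_pattern P Q \<longleftrightarrow> word_contains w u"
proof -
  have P: "partition_on {1..length w} P" "partition_on {1..length u} Q"
    and eq: "\<And>i j. i < length w \<Longrightarrow> j < length w \<Longrightarrow> same_block P (Suc i) (Suc j) \<longleftrightarrow> w ! i = w ! j"
      "\<And>i j. i < length u \<Longrightarrow> j < length u \<Longrightarrow> same_block Q (Suc i) (Suc j) \<longleftrightarrow> u ! i = u ! j"
    using assms by (auto simp: represents_def)
  show ?thesis
    unfolding contains_pattern_iff[OF P] word_contains_def
  proof safe
    fix f assume f: "strict_mono_on {1..length u} f" "f ` {1..length u} \<subseteq> {1..length w}"
      "\<forall>x\<in>{1..length u}. \<forall>y\<in>{1..length u}. same_block P (f x) (f y) = same_block Q x y"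
    have rng: "1 \<le> f (Suc x) \<and> f (Suc x) \<le> length w" if "x < length u" for x
      using f(2) that by (auto simp: image_subset_iff)
    show "\<exists>f. strict_mono_on {..<length u} f \<and> f ` {..<length u} \<subseteq> {..<length w} \<and>
      (\<forall>x<length u. \<forall>y<length u. (w ! f x = w ! f y) = (u ! x = u ! y))"
    proof (intro exI[of _ "\<lambda>x. f (Suc x) - 1"] conjI allI impI)
      show "strict_mono_on {..<length u} (\<lambda>x. f (Suc x) - 1)"
      proof (rule strict_mono_onI)
        fix x y assume xy: "x \<in> {..<length u}" "y \<in> {..<length u}" "x < y"
        then have "f (Suc x) < f (Suc y)" by (intro strict_mono_onD[OF f(1)]) auto
        then show "f (Suc x) - 1 < f (Suc y) - 1" using rng[of x] xy by auto
      qed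
      show "(\<lambda>x. f (Suc x) - 1) ` {..<length u} \<subseteq> {..<length w}"
        using rng by fastforce
      fix x y assume xy: "x < length u" "y < length u"
      then have "same_block P (f (Suc x)) (f (Suc y)) = (w ! (f (Suc x) - 1) = w ! (f (Suc y) - 1))"
        using eq(1)[of "f (Suc x) - 1" "f (Suc y) - 1"] rng[of x] rng[of y] by auto
      then show "(w ! (f (Suc x) - 1) = w ! (f (Suc y) - 1)) = (u ! x = u ! y)"
        using f(3) eq(2)[OF xy] xy by auto
    qed
  next
    fix f assume f: "strict_mono_on {..<length u} f" "f ` {..<length u} \<subseteq> {..<length w}"
      "\<forall>x<length u. \<forall>y<length u. (w ! f x = w ! f y) = (u ! x = u ! y)"
    show "\<exists>f. strict_mono_on {1..length u} f \<and> f ` {1..length u} \<subseteq> {1..length w} \<and>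
      (\<forall>x\<in>{1..length u}. \<forall>y\<in>{1..length u}. same_block P (f x) (f y) = same_block Q x y)"
    proof (intro exI[of _ "\<lambda>x. Suc (f (x - 1))"] conjI ballI)
      show "strict_mono_on {1..length u} (\<lambda>x. Suc (f (x - 1)))"
      proof (rule strict_mono_onI)
        fix x y assume xy: "x \<in> {1..length u}" "y \<in> {1..length u}" "x < y"
        then have "f (x - 1) < f (y - 1)" by (intro strict_mono_onD[OF f(1)]) auto
        then show "Suc (f (x - 1)) < Suc (f (y - 1))" by simp
      qed
      show "(\<lambda>x. Suc (f (x - 1))) ` {1..length u} \<subseteq> {1..length w}"
        using f(2) by (auto simp: image_subset_iff Suc_le_eq)
      fix x y assume xy: "x \<in> {1..length u}" "y \<in> {1..length u}"
      have "same_block P (Suc (f (x - 1))) (Suc (f (y - 1))) = (w ! f (x - 1) = w ! f (y - 1))"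
        using f(2) xy by (intro eq) (auto simp: image_subset_iff)
      also have "\<dots> = (u ! (x - 1) = u ! (y - 1))"
        using f(3) xy by auto
      also have "\<dots> = same_block Q x y"
        using eq(2)[of "x - 1" "y - 1"] xy by auto
      finally show "same_block P (Suc (f (x - 1))) (Suc (f (y - 1))) = same_block Q x y" .
    qed
  qed
qed

text \<open>All three patterns have length four, so the embedding unrolls into four positions and
  the six comparisons between them.\<close>

lemma word_contains_4:
  "word_contains w [a, b, c, d] \<longleftrightarrow>
    (\<exists>i j k l. i < j \<and> j < k \<and> k < l \<and> l < length w \<and>
      (w ! i = w ! j \<longleftrightarrow> a = b) \<and> (w ! i = w ! k \<longleftrightarrow> a = c) \<and> (w ! i = w ! l \<longleftrightarrow> a = d) \<and>
      (w ! j = w ! k \<longleftrightarrow> b = c) \<and> (w ! j = w ! l \<longleftrightarrow> b = d) \<and> (w ! k = w ! l \<longleftrightarrow> c = d))"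
    (is "?l \<longleftrightarrow> ?r")
proof
  have len: "length [a, b, c, d] = 4" by simp
  assume ?l
  then obtain f where f: "strict_mono_on {..<4} f" "f ` {..<4} \<subseteq> {..<length w}"
      "\<forall>x<4. \<forall>y<4. w ! f x = w ! f y \<longleftrightarrow> [a, b, c, d] ! x = [a, b, c, d] ! y"
    unfolding word_contains_def len by blast
  have "f 0 < f 1" "f 1 < f 2" "f 2 < f 3"
    by (rule strict_mono_onD[OF f(1)]; simp)+
  moreover have "f 3 < length w"
    using f(2) by (simp add: image_subset_iff)
  moreover have "w ! f 0 = w ! f 1 \<longleftrightarrow> a = b"
    using f(3)[rule_format, of 0 1] by simp
  moreover have "w ! f 0 = w ! f 2 \<longleftrightarrow> a = c"
    using f(3)[rule_format, of 0 2] by simp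
  moreover have "w ! f 0 = w ! f 3 \<longleftrightarrow> a = d"
    using f(3)[rule_format, of 0 3] by simp
  moreover have "w ! f 1 = w ! f 2 \<longleftrightarrow> b = c"
    using f(3)[rule_format, of 1 2] by simp
  moreover have "w ! f 1 = w ! f 3 \<longleftrightarrow> b = d"
    using f(3)[rule_format, of 1 3] by simp
  moreover have "w ! f 2 = w ! f 3 \<longleftrightarrow> c = d"
    using f(3)[rule_format, of 2 3] by simp
  ultimately show ?r by blast
next
  assume ?r
  then obtain i j k l where *: "i < j" "j < k" "k < l" "l < length w"
      "w ! i = w ! j \<longleftrightarrow> a = b" "w ! i = w ! k \<longleftrightarrow> a = c" "w ! i = w ! l \<longleftrightarrow> a = d"
      "w ! j = w ! k \<longleftrightarrow> b = c" "w ! j = w ! l \<longleftrightarrow> b = d" "w ! k = w ! l \<longleftrightarrow> c = d"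
    by blast
  have less4: "{..<length [a, b, c, d]} = {0, 1, 2, 3}" by auto
  define f where "f = (!) [i, j, k, l]"
  have f: "f 0 = i" "f 1 = j" "f 2 = k" "f 3 = l" by (simp_all add: f_def)
  have "strict_mono_on {..<length [a, b, c, d]} f"
    unfolding less4 by (rule strict_mono_onI) (use *(1-4) f in auto)
  moreover have "f ` {..<length [a, b, c, d]} \<subseteq> {..<length w}"
    unfolding less4 using *(1-4) f by simp
  moreover have "\<forall>x<length [a, b, c, d]. \<forall>y<length [a, b, c, d].
      w ! f x = w ! f y \<longleftrightarrow> [a, b, c, d] ! x = [a, b, c, d] ! y"
  proof -
    have all4: "(\<forall>x<length [a, b, c, d]. Q x) \<longleftrightarrow> Q 0 \<and> Q 1 \<and> Q 2 \<and> Q 3" for Q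
      by (auto simp: less_Suc_eq numeral_eq_Suc)
    show ?thesis
      unfolding all4 f using *(5-10) by simp metis
  qed
  ultimately show ?l unfolding word_contains_def by blast
qed

lemma represents_pat:
  "represents [1, 2, 3, 1] pat_14_2_3"
  "represents [1, 2, 3, 2] pat_1_24_3"
  "represents [1, 2, 1, 3] pat_13_2_4"
proof -
  have lt: "(\<forall>x<length [a, b, c, d]. Q x) \<longleftrightarrow> Q 0 \<and> Q 1 \<and> Q 2 \<and> Q 3" for a b c d :: nat and Q
    by (auto simp: less_Suc_eq numeral_eq_Suc)
  have 4: "{1..length [a, b, c, d]} = {1, 2, 3, 4}" for a b c d :: nat by auto
  note defs = represents_def lt 4 same_block_def
  show "represents [1, 2, 3, 1] pat_14_2_3"
    unfolding defs pat_14_2_3_def by (simp add: partition_on_def disjoint_def insert_commute)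
  show "represents [1, 2, 3, 2] pat_1_24_3"
    unfolding defs pat_1_24_3_def by (simp add: partition_on_def disjoint_def insert_commute)
  show "represents [1, 2, 1, 3] pat_13_2_4"
    unfolding defs pat_13_2_4_def by (simp add: partition_on_def disjoint_def insert_commute)
qed

subsection \<open>Restricted growth functions\<close>

text \<open>This is equivalent to bounding each letter by one plus the maximum of the earlier ones.
  The present form yields earlier occurrences of smaller letters directly.\<close>

definition is_rgf :: "nat list \<Rightarrow> bool" where
  "is_rgf w \<longleftrightarrow> (\<forall>i<length w. 1 \<le> w ! i \<and> {1..<w ! i} \<subseteq> set (take i w))"

lemma is_rgf_take: "is_rgf w \<Longrightarrow> is_rgf (take k w)"
  unfolding is_rgf_def by (simp add: min_def)

lemma is_rgf_pos: "is_rgf w \<Longrightarrow> x \<in> set w \<Longrightarrow> 1 \<le> x"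
  by (auto simp: is_rgf_def in_set_conv_nth)

lemma is_rgf_downward:
  assumes "is_rgf w" "x \<in> set w" "1 \<le> y" "y \<le> x"
  shows "y \<in> set w"
proof (cases "y = x")
  case False
  obtain i where i: "i < length w" "w ! i = x"
    using assms(2) by (auto simp: in_set_conv_nth)
  then have "{1..<x} \<subseteq> set (take i w)"
    using assms(1) by (auto simp: is_rgf_def)
  moreover have "y \<in> {1..<x}" using assms False by simp
  ultimately show ?thesis using set_take_subset[of i w] by blast
qed (use assms in simp)

text \<open>The letters are positive and closed downwards. Hence \<open>card (set w)\<close> is also
  the largest letter, the role in which it is used from here on.\<close>

lemma set_is_rgf:
  assumes "is_rgf w"
  shows "set w = {1..card (set w)}"
proof (cases "w = []")
  case False
  then have "Max (set w) \<in> set w" by simp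
  have "set w = {1..Max (set w)}"
  proof (intro set_eqI iffI)
    fix x assume "x \<in> set w"
    then show "x \<in> {1..Max (set w)}" using is_rgf_pos[OF assms] by simp
  next
    fix x assume "x \<in> {1..Max (set w)}"
    then show "x \<in> set w"
      using is_rgf_downward[OF assms \<open>Max (set w) \<in> set w\<close>] by simp
  qed
  moreover from this have "card (set w) = Max (set w)"
    by (metis card_atLeastAtMost diff_Suc_1)
  ultimately show ?thesis by metis
qed simp

lemma is_rgf_mem_iff: "is_rgf w \<Longrightarrow> x \<in> set w \<longleftrightarrow> 1 \<le> x \<and> x \<le> card (set w)"
  using set_is_rgf[of w] by (metis atLeastAtMost_iff)

text \<open>Induction on the position: a repeated letter is copied from an earlier position, and a
  letter occurring for the first time must be one more than the number of distinct letters before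
  it. So the equalities between positions determine the word.\<close>

lemma is_rgf_eqI:
  assumes rgf: "is_rgf w" "is_rgf w'" and len: "length w = length w'"
    and eq: "\<And>i j. i < length w \<Longrightarrow> j < length w \<Longrightarrow> w ! i = w ! j \<longleftrightarrow> w' ! i = w' ! j"
  shows "w = w'"
proof (rule nth_equalityI[OF len])
  have new: "v ! i = Suc (card (set (take i v)))"
    if "is_rgf v" "i < length v" "v ! i \<notin> set (take i v)" for v i
  proof -
    have s: "set (take i v) = {1..card (set (take i v))}"
      using set_is_rgf[OF is_rgf_take[OF that(1)]] .
    have "{1..<v ! i} \<subseteq> set (take i v)" "1 \<le> v ! i"
      using that by (auto simp: is_rgf_def)
    then have "{1..<v ! i} \<subseteq> {1..card (set (take i v))}" "\<not> v ! i \<le> card (set (take i v))"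
      using s that(3) by (metis, metis atLeastAtMost_iff)
    moreover have "a = Suc c" if "{1..<a} \<subseteq> {1..c}" "\<not> a \<le> c" "1 \<le> a" for a c :: nat
      using that by (cases "a = 1") (auto simp: subset_iff dest: spec[of _ "a - 1"])
    ultimately show ?thesis
      using \<open>1 \<le> v ! i\<close> by blast
  qed
  fix i assume "i < length w"
  then show "w ! i = w' ! i"
  proof (induction i rule: less_induct)
    case (less i)
    then have "take i w = take i w'"
      using len by (intro nth_equalityI) auto
    moreover have old: "w ! i \<in> set (take i w) \<longleftrightarrow> (\<exists>j<i. w ! j = w ! i)"
        "w' ! i \<in> set (take i w') \<longleftrightarrow> (\<exists>j<i. w' ! j = w' ! i)"
      using less.prems len by (auto simp: in_set_conv_nth)
    have same: "(\<exists>j<i. w ! j = w ! i) \<longleftrightarrow> (\<exists>j<i. w' ! j = w' ! i)"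
      using eq less.prems by (meson less_trans)
    show ?case
    proof (cases "\<exists>j<i. w ! j = w ! i")
      case True
      then obtain j where "j < i" "w ! j = w ! i" by blast
      then show ?thesis using less.IH[of j] less.prems eq[of j i] by auto
    next
      case False
      then show ?thesis
        using new[OF rgf(1) less.prems] new[OF rgf(2), of i] old same less.prems len calculation
        by simp
    qed
  qed
qed

section \<open>Words and the set partitions they represent\<close>

lemma represents_exists: "\<exists>P. represents w P"
proof -
  \<comment> \<open>The blocks are the classes of elements whose positions carry equal letters;
    element \<open>x\<close> sits at list index \<open>x - 1\<close>.\<close>
  let ?r = "{(x, y). x \<in> {1..length w} \<and> y \<in> {1..length w} \<and> w ! (x - 1) = w ! (y - 1)}"
  have eq: "equiv {1..length w} ?r"
    by (auto simp: equiv_def refl_on_def sym_def trans_def)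
  have "same_block ({1..length w} // ?r) x y \<longleftrightarrow> w ! (x - 1) = w ! (y - 1)"
    if xy: "x \<in> {1..length w}" "y \<in> {1..length w}" for x y
  proof
    assume "same_block ({1..length w} // ?r) x y"
    then obtain B where "B \<in> {1..length w} // ?r" "x \<in> B" "y \<in> B"
      by (auto simp: same_block_def)
    then have "(x, y) \<in> ?r" using quotient_eq_iff[OF eq, of B B x y] by blast
    then show "w ! (x - 1) = w ! (y - 1)" by simp
  next
    assume "w ! (x - 1) = w ! (y - 1)"
    then have "x \<in> ?r `` {x}" "y \<in> ?r `` {x}" using xy by auto
    moreover have "?r `` {x} \<in> {1..length w} // ?r" using xy(1) by (rule quotientI)
    ultimately show "same_block ({1..length w} // ?r) x y"
      unfolding same_block_def by (intro bexI[of _ "?r `` {x}"] conjI)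
  qed
  then have "represents w ({1..length w} // ?r)"
    using partition_on_quotient[OF eq] unfolding represents_def by simp
  then show ?thesis by blast
qed

lemma length_rgf [simp]: "length (rgf n P) = n"
  by (simp add: rgf_def)

context
  fixes n :: nat and P :: "nat set set" assumes P: "partition_on {1..n} P"
begin

lemma block_of: "i \<in> {1..n} \<Longrightarrow> block_of P i \<in> P \<and> i \<in> block_of P i"
proof -
  assume "i \<in> {1..n}"
  then obtain B where "B \<in> P" "i \<in> B" using partition_onD1[OF P] by blast
  moreover from this have "C = B" if "C \<in> P" "i \<in> C" for C
    using partition_onD2[OF P] that by (auto simp: disjoint_def)
  ultimately have "\<exists>!B. B \<in> P \<and> i \<in> B" by blast
  then show ?thesis unfolding block_of_def by (rule theI')
qed

lemma block_of_eq: "B \<in> P \<Longrightarrow> i \<in> B \<Longrightarrow> block_of P i = B"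
  using partition_onD2[OF P] partition_onD1[OF P] block_of[of i]
  unfolding disjoint_def by blast

lemma finite_blocks: "finite P" "B \<in> P \<Longrightarrow> finite B" "B \<in> P \<Longrightarrow> B \<noteq> {}"
proof -
  show "finite P" using finite_elements[OF _ P] by simp
  show "B \<in> P \<Longrightarrow> finite B"
    using partition_onD1[OF P] by (intro finite_subset[of B "{1..n}"]) blast+
  show "B \<in> P \<Longrightarrow> B \<noteq> {}" using partition_onD3[OF P] by blast
qed

lemma Min_block: "B \<in> P \<Longrightarrow> Min B \<in> B"
  using finite_blocks by simp

lemma Min_block_inj: "B \<in> P \<Longrightarrow> C \<in> P \<Longrightarrow> Min B = Min C \<Longrightarrow> B = C"
  using Min_block block_of_eq by metis

lemma block_index_less:
  assumes "B \<in> P" "C \<in> P" "Min B < Min C"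
  shows "block_index P B < block_index P C"
  unfolding block_index_def
proof (rule psubset_card_mono)
  show "{D \<in> P. Min D \<le> Min B} \<subset> {D \<in> P. Min D \<le> Min C}"
    using assms by (auto simp: psubset_eq set_eq_iff intro!: exI[of _ C])
qed (simp add: finite_blocks)

lemma block_index_inj:
  assumes "B \<in> P" "C \<in> P"
  shows "block_index P B = block_index P C \<longleftrightarrow> B = C"
  using block_index_less[OF assms] block_index_less[OF assms(2,1)] Min_block_inj[OF assms]
  by (metis less_irrefl linorder_neqE_nat)

lemma block_index_image: "block_index P ` P = {1..card P}"
proof (rule card_subset_eq)
  have "1 \<le> block_index P B \<and> block_index P B \<le> card P" if "B \<in> P" for B
  proof
    have "{B} \<subseteq> {C \<in> P. Min C \<le> Min B}" using that by auto
    then have "card {B} \<le> block_index P B"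
      unfolding block_index_def by (intro card_mono) (simp_all add: finite_blocks)
    then show "1 \<le> block_index P B" by simp
    show "block_index P B \<le> card P"
      unfolding block_index_def by (intro card_mono) (auto simp: finite_blocks)
  qed
  then show "block_index P ` P \<subseteq> {1..card P}" by auto
  have "inj_on (block_index P) P"
    by (auto simp: inj_on_def block_index_inj)
  then show "card (block_index P ` P) = card {1..card P}"
    by (simp add: card_image)
qed simp

lemma rgf_nth: "i < n \<Longrightarrow> rgf n P ! i = block_index P (block_of P (Suc i))"
  by (simp add: rgf_def del: upt_Suc)

lemma represents_rgf: "represents (rgf n P) P"
proof -
  have "same_block P (Suc i) (Suc j) \<longleftrightarrow> rgf n P ! i = rgf n P ! j" if "i < n" "j < n" for i j
  proof -
    have ij: "block_of P (Suc i) \<in> P" "Suc i \<in> block_of P (Suc i)"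
        "block_of P (Suc j) \<in> P" "Suc j \<in> block_of P (Suc j)"
      using that block_of by auto
    then have "same_block P (Suc i) (Suc j) \<longleftrightarrow> block_of P (Suc i) = block_of P (Suc j)"
      unfolding same_block_def using block_of_eq by metis
    then show ?thesis
      using that ij by (simp add: rgf_nth block_index_inj)
  qed
  then show ?thesis using P by (simp add: represents_def)
qed

text \<open>A letter \<open>c\<close> smaller than the one at index \<open>i\<close> numbers a block
  \<open>C\<close> with a smaller minimum than the block of \<open>Suc i\<close>. That minimum is
  therefore below \<open>Suc i\<close>, and its position carries \<open>c\<close>.\<close>

lemma is_rgf_rgf: "is_rgf (rgf n P)"
  unfolding is_rgf_def length_rgf
proof (intro allI impI conjI subsetI)
  fix i assume i: "i < n"
  let ?B = "block_of P (Suc i)"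
  have B: "?B \<in> P" "Suc i \<in> ?B" using i block_of by auto
  have idx: "block_index P ?B \<in> {1..card P}" using B block_index_image by blast
  then show "1 \<le> rgf n P ! i" using rgf_nth[OF i] by simp
  fix c assume "c \<in> {1..<rgf n P ! i}"
  then have c: "1 \<le> c" "c < block_index P ?B" using rgf_nth[OF i] by auto
  then have "c \<in> block_index P ` P" unfolding block_index_image using idx by simp
  then obtain C where C: "C \<in> P" "c = block_index P C" by blast
  have "\<not> Min ?B < Min C" using block_index_less[OF B(1) C(1)] c C by auto
  moreover have "Min C \<noteq> Min ?B" using Min_block_inj[OF C(1) B(1)] c C by auto
  ultimately have "Min C < Min ?B" by simp
  also have "\<dots> \<le> Suc i" using B finite_blocks by (intro Min_le) auto
  finally have "Min C < Suc i" .
  moreover have "Min C \<in> {1..n}" using Min_block[OF C(1)] C(1) partition_onD1[OF P] by blast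
  ultimately have j: "Min C - 1 < i" "Suc (Min C - 1) = Min C" by auto
  then have "rgf n P ! (Min C - 1) = c"
    using C i block_of_eq[OF C(1) Min_block[OF C(1)]] by (simp add: rgf_nth)
  then show "c \<in> set (take i (rgf n P))"
    using j i by (auto simp: in_set_conv_nth intro!: exI[of _ "Min C - 1"])
qed

end

text \<open>A restricted growth function \<open>w\<close> represents some partition
  \<open>P\<close>. Since \<open>rgf n P\<close> is a restricted growth function with the same
  equalities between positions, it is \<open>w\<close>; thus every such word arises from a
  partition.\<close>

lemma R_eq:
  assumes "represents u p" "represents v q"
  shows "R n p q = {w. length w = n \<and> is_rgf w \<and> \<not> word_contains w u \<and> \<not> word_contains w v}"
proof (intro set_eqI iffI)
  fix w assume "w \<in> R n p q"
  then obtain P where P: "partition_on {1..n} P" "avoids P p" "avoids P q" and w: "w = rgf n P"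
    by (auto simp: R_def)
  then show "w \<in> {w. length w = n \<and> is_rgf w \<and> \<not> word_contains w u \<and> \<not> word_contains w v}"
    using contains_pattern_represents[OF represents_rgf[OF P(1)]] assms is_rgf_rgf[OF P(1)]
    by (simp add: avoids_def)
next
  fix w assume w: "w \<in> {w. length w = n \<and> is_rgf w \<and> \<not> word_contains w u \<and> \<not> word_contains w v}"
  obtain P where rep: "represents w P" using represents_exists by blast
  have P: "partition_on {1..n} P" using rep w by (simp add: represents_def)
  have "avoids P p" "avoids P q"
    using contains_pattern_represents[OF rep] assms w by (auto simp: avoids_def)
  moreover have "w = rgf n P"
    using w is_rgf_rgf[OF P] represents_rgf[OF P] rep
    by (intro is_rgf_eqI) (auto simp: represents_def)
  ultimately show "w \<in> R n p q" using P by (auto simp: R_def)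
qed

subsection \<open>The words avoiding the two pairs of patterns\<close>

lemma is_rgf_earlier:
  assumes "is_rgf w" "i < length w" "1 \<le> c" "c < w ! i"
  obtains j where "j < i" "w ! j = c"
proof -
  have "c \<in> set (take i w)"
    using assms by (force simp: is_rgf_def)
  then show ?thesis
    using assms(2) that by (auto simp: in_set_conv_nth)
qed

text \<open>An inversion whose larger letter exceeds 2 has before it both its smaller letter and
  another letter from \<open>{1, 2}\<close>; their order decides which pattern occurs. Conversely,
  the sortedness condition would force the three distinct letters of an occurrence into
  \<open>{1, 2}\<close>.\<close>

lemma avoids_1231_1232_iff:
  assumes w: "is_rgf w"
  shows "\<not> word_contains w [1, 2, 3, 1] \<and> \<not> word_contains w [1, 2, 3, 2] \<longleftrightarrow>
    sorted_wrt (\<lambda>x y. x \<le> y \<or> x \<le> 2) w" (is "?avoids \<longleftrightarrow> ?sorted")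
proof
  assume avoids: ?avoids
  show ?sorted
    unfolding sorted_wrt_iff_nth_less
  proof (intro allI impI)
    fix i j assume ij: "i < j" "j < length w"
    show "w ! i \<le> w ! j \<or> w ! i \<le> 2"
    proof (rule ccontr)
      assume "\<not> ?thesis"
      then have gt: "w ! j < w ! i" "2 < w ! i" by auto
      have pos: "1 \<le> w ! j" using is_rgf_pos[OF w] ij by simp
      obtain k where k: "k < i" "w ! k = w ! j"
        by (rule is_rgf_earlier[OF w, of i "w ! j"]) (use pos gt ij in simp_all)
      \<comment> \<open>A letter from \<open>{1, 2}\<close> different from \<open>w ! j\<close>; it
        is below \<open>w ! i\<close> because \<open>w ! i\<close> exceeds 2.\<close>
      define d where "d = (if w ! j = 1 then 2 else 1 :: nat)"
      have d: "1 \<le> d" "d < w ! i" "d \<noteq> w ! j" using gt by (auto simp: d_def)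
      obtain l where l: "l < i" "w ! l = d"
        by (rule is_rgf_earlier[OF w, of i d]) (use d ij in simp_all)
      show False
      proof (cases "k < l")
        case True
        then have "word_contains w [1, 2, 3, 1]"
          unfolding word_contains_4 using ij gt k l d
          by (intro exI[of _ k] exI[of _ l] exI[of _ i] exI[of _ j]) simp
        then show False using avoids by simp
      next
        case False
        moreover have "k \<noteq> l" using k l d by auto
        ultimately have "word_contains w [1, 2, 3, 2]"
          unfolding word_contains_4 using ij gt k l d
          by (intro exI[of _ l] exI[of _ k] exI[of _ i] exI[of _ j]) simp
        then show False using avoids by simp
      qed
    qed
  qed
next
  assume ?sorted
  then have le: "w ! i \<le> w ! j \<or> w ! i \<le> 2" if "i < j" "j < length w" for i j
    using that by (simp add: sorted_wrt_iff_nth_less)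
  have pos: "1 \<le> w ! i" if "i < length w" for i
    using is_rgf_pos[OF w] that by simp
  show ?avoids
  proof (intro conjI notI)
    assume "word_contains w [1, 2, 3, 1]"
    then obtain i j k l where "i < j" "j < k" "k < l" "l < length w" "w ! i = w ! l"
        "w ! i \<noteq> w ! j" "w ! i \<noteq> w ! k" "w ! j \<noteq> w ! k"
      by (auto simp: word_contains_4)
    then show False
      using le[of i j] le[of i k] le[of j l] le[of k l] pos[of i] pos[of j] pos[of k] by linarith
  next
    assume "word_contains w [1, 2, 3, 2]"
    then obtain i j k l where "i < j" "j < k" "k < l" "l < length w" "w ! j = w ! l"
        "w ! i \<noteq> w ! j" "w ! i \<noteq> w ! k" "w ! j \<noteq> w ! k"
      by (auto simp: word_contains_4)
    then show False
      using le[of i j] le[of j k] le[of k l] pos[of i] pos[of j] pos[of k] by linarith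
  qed
qed

text \<open>Given an inversion, avoidance makes every third letter smaller than both of its letters,
  so these are the two largest. Conversely, each pattern has a letter enclosed by two copies of
  another, which gives an inversion and hence the two largest letters; the remaining letter of the
  occurrence then has no possible value.\<close>

lemma avoids_1231_1213_iff:
  assumes w: "is_rgf w"
  shows "\<not> word_contains w [1, 2, 3, 1] \<and> \<not> word_contains w [1, 2, 1, 3] \<longleftrightarrow>
    sorted_wrt (\<lambda>x y. x \<le> y \<or> x = card (set w) \<and> Suc y = card (set w)) w"
    (is "?avoids \<longleftrightarrow> ?sorted")
proof
  note set = is_rgf_mem_iff[OF w]
  assume avoids: ?avoids
  show ?sorted
    unfolding sorted_wrt_iff_nth_less
  proof (intro allI impI)
    fix i j assume ij: "i < j" "j < length w"
    show "w ! i \<le> w ! j \<or> w ! i = card (set w) \<and> Suc (w ! j) = card (set w)"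
    proof (cases "w ! i \<le> w ! j")
      case False
      then have gt: "w ! j < w ! i" by simp
      have pos: "1 \<le> w ! j" using is_rgf_pos[OF w] ij by simp
      obtain k' where k': "k' < i" "w ! k' = w ! j"
        by (rule is_rgf_earlier[OF w, of i "w ! j"]) (use gt pos ij in simp_all)
      \<comment> \<open>The first occurrence of \<open>w ! j\<close> in the word. By restricted
        growth no larger letter precedes it either.\<close>
      define k where "k = (LEAST k. w ! k = w ! j)"
      have k: "k < i" "w ! k = w ! j"
        using k' Least_le[of "\<lambda>k. w ! k = w ! j" k'] LeastI[of "\<lambda>k. w ! k = w ! j" k']
        by (auto simp: k_def)
      have first: "w ! p \<noteq> w ! j" if "p < k" for p
        using that not_less_Least unfolding k_def by blast
      \<comment> \<open>A position \<open>p\<close> of a third letter is compared with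
        \<open>k < i < j\<close>. Before \<open>k\<close> growth bounds the letter; between
        \<open>k\<close> and \<open>j\<close> it would complete 1231, and after \<open>j\<close> it
        would complete 1213.\<close>
      have other: "x < w ! j" if x: "x \<in> set w" "x \<noteq> w ! i" "x \<noteq> w ! j" for x
      proof -
        obtain p where p: "p < length w" "w ! p = x"
          using x(1) by (auto simp: in_set_conv_nth)
        have "p \<noteq> i" "p \<noteq> j" "p \<noteq> k" using p x k by auto
        then consider "p < k" | "k < p" "p < i" | "i < p" "p < j" | "j < p"
          by linarith
        then show ?thesis
        proof cases
          case 1
          show ?thesis
          proof (rule ccontr)
            assume "\<not> ?thesis"
            then have "w ! j < w ! p" using x p by simp
            with is_rgf_earlier[OF w p(1) pos] obtain q where "q < p" "w ! q = w ! j"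
              by blast
            then show False using first 1 by auto
          qed
        next
          case 2
          then have "word_contains w [1, 2, 3, 1]"
            unfolding word_contains_4 using ij gt k p x
            by (intro exI[of _ k] exI[of _ p] exI[of _ i] exI[of _ j]) simp
          then show ?thesis using avoids by simp
        next
          case 3
          then have "word_contains w [1, 2, 3, 1]"
            unfolding word_contains_4 using ij gt k p x
            by (intro exI[of _ k] exI[of _ i] exI[of _ p] exI[of _ j]) simp
          then show ?thesis using avoids by simp
        next
          case 4
          then have "word_contains w [1, 2, 1, 3]"
            unfolding word_contains_4 using ij gt k p x
            by (intro exI[of _ k] exI[of _ i] exI[of _ j] exI[of _ p]) simp
          then show ?thesis using avoids by simp
        qed
      qed
      have i: "w ! i \<in> set w" using ij by simp
      \<comment> \<open>Applying \<open>other\<close> to the largest letter, and below to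
        \<open>w ! i - 1\<close>, rules out a letter above \<open>w ! i\<close> and one between
        \<open>w ! j\<close> and \<open>w ! i\<close>.\<close>
      have "w ! i = card (set w)"
        using other[of "card (set w)"] i gt set[of "w ! i"] set[of "card (set w)"] by linarith
      moreover have "Suc (w ! j) = w ! i"
        using other[of "w ! i - 1"] i gt pos set[of "w ! i"] set[of "w ! i - 1"] by linarith
      ultimately show ?thesis by simp
    qed simp
  qed
next
  assume ?sorted
  then have le: "w ! i \<le> w ! j \<or> w ! i = card (set w) \<and> Suc (w ! j) = card (set w)"
    if "i < j" "j < length w" for i j
    using that by (simp add: sorted_wrt_iff_nth_less)
  have bound: "w ! i \<le> card (set w)" if "i < length w" for i
    using is_rgf_mem_iff[OF w] that nth_mem by blast
  show ?avoids
  proof (intro conjI notI)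
    assume "word_contains w [1, 2, 3, 1]"
    then obtain i j k l where "i < j" "j < k" "k < l" "l < length w" "w ! i = w ! l"
        "w ! i \<noteq> w ! j" "w ! i \<noteq> w ! k" "w ! j \<noteq> w ! k"
      by (auto simp: word_contains_4)
    then show False
      using le[of i j] le[of i k] le[of j l] le[of k l] by linarith
  next
    assume "word_contains w [1, 2, 1, 3]"
    then obtain i j k l where "i < j" "j < k" "k < l" "l < length w" "w ! i = w ! k"
        "w ! i \<noteq> w ! j" "w ! i \<noteq> w ! l" "w ! j \<noteq> w ! l"
      by (auto simp: word_contains_4)
    then show False
      using le[of i j] le[of j k] le[of i l] le[of j l] bound[of l] by linarith
  qed
qed

section \<open>Gluing and cutting restricted growth functions\<close>

lemma is_rgf_append_shift:
  assumes x: "is_rgf x" and y: "is_rgf y"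
  shows "is_rgf (x @ map (\<lambda>a. a + card (set x)) y)"
  unfolding is_rgf_def
proof (intro allI impI)
  let ?w = "x @ map (\<lambda>a. a + card (set x)) y"
  fix i assume i: "i < length ?w"
  show "1 \<le> ?w ! i \<and> {1..<?w ! i} \<subseteq> set (take i ?w)"
  proof (cases "i < length x")
    case True
    then show ?thesis using x by (auto simp: is_rgf_def nth_append)
  next
    case False
    define j where "j = i - length x"
    have j: "i = length x + j" "j < length y" using False i by (auto simp: j_def)
    have nth: "?w ! i = y ! j + card (set x)" using j by (simp add: nth_append)
    have take: "set (take i ?w) = set x \<union> (\<lambda>a. a + card (set x)) ` set (take j y)"
      using j by (simp add: take_map)
    \<comment> \<open>Letters up to \<open>card (set x)\<close> all occur in \<open>x\<close>;
      larger ones are supplied by the growth of \<open>y\<close>, shifted.\<close>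
    have "c \<in> set (take i ?w)" if c: "c \<in> {1..<?w ! i}" for c
    proof (cases "c \<le> card (set x)")
      case True
      then have "c \<in> {1..card (set x)}" using c by simp
      then have "c \<in> set x" using set_is_rgf[OF x] by metis
      then show ?thesis using take by simp
    next
      case False
      then have "c - card (set x) \<in> {1..<y ! j}" using c nth by auto
      then have "c - card (set x) \<in> set (take j y)"
        using y j(2) unfolding is_rgf_def by blast
      then have "c - card (set x) + card (set x) \<in> set (take i ?w)"
        using take by blast
      then show ?thesis using False by simp
    qed
    then have "{1..<?w ! i} \<subseteq> set (take i ?w)" by blast
    moreover have "1 \<le> y ! j" using y j by (simp add: is_rgf_def)
    ultimately show ?thesis unfolding nth by simp
  qed
qed

lemma is_rgf_appendD1: "is_rgf (x @ y) \<Longrightarrow> is_rgf x"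
  using is_rgf_take[of "x @ y" "length x"] by simp

lemma is_rgf_appendD2:
  assumes w: "is_rgf (x @ y)" and x: "\<forall>a\<in>set x. a \<le> k" and y: "\<forall>a\<in>set y. k < a"
  shows "is_rgf (map (\<lambda>a. a - k) y)"
  unfolding is_rgf_def
proof (intro allI impI conjI subsetI)
  fix i assume "i < length (map (\<lambda>a. a - k) y)"
  then have i: "i < length y" by simp
  have k: "k < y ! i" using i y by simp
  then show "1 \<le> map (\<lambda>a. a - k) y ! i" using i by simp
  fix c assume "c \<in> {1..<map (\<lambda>a. a - k) y ! i}"
  then have c: "1 \<le> c" "c + k < y ! i" using i by auto
  have "{1..<(x @ y) ! (length x + i)} \<subseteq> set (take (length x + i) (x @ y))"
    using w i unfolding is_rgf_def by (metis length_append nat_add_left_cancel_less)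
  then have "{1..<y ! i} \<subseteq> set x \<union> set (take i y)" by simp
  moreover have "c + k \<in> {1..<y ! i}" using c by simp
  ultimately have "c + k \<in> set x \<union> set (take i y)" by blast
  then have "c + k \<in> set (take i y)" using x c by auto
  then have "c + k - k \<in> (\<lambda>a. a - k) ` set (take i y)" by blast
  then show "c \<in> set (take i (map (\<lambda>a. a - k) y))" by (simp add: take_map)
qed

text \<open>
  The pair \<open>(v, t)\<close> consists of the part \<open>v\<close> on two adjacent letters and the weakly increasing
  part \<open>t\<close>, both standardized. The last condition makes the decomposition of a word unique:
  \<open>v\<close> may use a single letter only if it is the whole word.
\<close>

definition decomps :: "nat \<Rightarrow> (nat list \<times> nat list) set" where
  "decomps n = {(v, t). length v + length t = n \<and> is_rgf v \<and> set v \<subseteq> {1, 2} \<and>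
     is_rgf t \<and> sorted t \<and> (t \<noteq> [] \<longrightarrow> 2 \<in> set v)}"

definition binary_first :: "nat list \<times> nat list \<Rightarrow> nat list" where
  "binary_first = (\<lambda>(v, t). v @ map (\<lambda>a. a + 2) t)"

definition binary_last :: "nat list \<times> nat list \<Rightarrow> nat list" where
  "binary_last = (\<lambda>(v, t). t @ map (\<lambda>a. a + card (set t)) v)"

text \<open>For nonempty \<open>t\<close> the shift by 2 in \<open>binary_first\<close> is thus a
  shift by \<open>card (set v)\<close>, as gluing requires.\<close>

lemma decomps_set:
  assumes "(v, t) \<in> decomps n" "t \<noteq> []"
  shows "set v = {1, 2}"
  using assms is_rgf_downward[of v 2 1] by (auto simp: decomps_def)

text \<open>To decompose a word, cut it before its first letter exceeding 2. No later letter can be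
  at most 2, since that would be an inversion whose larger letter exceeds 2.\<close>

lemma binary_first_image:
  "binary_first ` decomps n =
    {w. length w = n \<and> is_rgf w \<and> sorted_wrt (\<lambda>x y. x \<le> y \<or> x \<le> 2) w}"
proof (intro set_eqI iffI)
  fix w assume "w \<in> binary_first ` decomps n"
  then obtain v t where vt: "(v, t) \<in> decomps n" and w: "w = v @ map (\<lambda>a. a + 2) t"
    by (auto simp: binary_first_def)
  note vt' = vt[unfolded decomps_def, simplified]
  have "is_rgf w"
  proof (cases "t = []")
    case False
    then have "card (set v) = 2" using decomps_set[OF vt] by simp
    then show ?thesis using is_rgf_append_shift[of v t] vt' w by simp
  qed (use vt' w in simp)
  moreover have le2: "x \<le> 2" if "x \<in> set v" for x
    using that vt' by auto
  moreover have "sorted_wrt (\<lambda>x y. x \<le> y \<or> x \<le> 2) v"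
    unfolding sorted_wrt_iff_nth_less using le2 nth_mem[of _ v] by simp
  moreover have "sorted_wrt (\<lambda>x y. x \<le> y \<or> x \<le> 2) (map (\<lambda>a. a + 2) t)"
    unfolding sorted_wrt_map using vt' by (auto intro: sorted_wrt_mono_rel[of t "(\<le>)"])
  ultimately show "w \<in> {w. length w = n \<and> is_rgf w \<and> sorted_wrt (\<lambda>x y. x \<le> y \<or> x \<le> 2) w}"
    using vt' w by (simp add: sorted_wrt_append)
next
  fix w assume "w \<in> {w. length w = n \<and> is_rgf w \<and> sorted_wrt (\<lambda>x y. x \<le> y \<or> x \<le> 2) w}"
  then have w: "length w = n" "is_rgf w" "sorted_wrt (\<lambda>x y. x \<le> y \<or> x \<le> 2) w" by auto
  define v y where "v = takeWhile (\<lambda>a. a \<le> 2) w" and "y = dropWhile (\<lambda>a. a \<le> 2) w"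
  have vy: "v @ y = w" by (simp add: v_def y_def)
  have v: "\<forall>a\<in>set v. a \<le> 2" unfolding v_def using set_takeWhileD by fastforce
  have sy: "sorted_wrt (\<lambda>x y. x \<le> y \<or> x \<le> 2) y"
    using w(3) unfolding vy[symmetric] sorted_wrt_append by blast
  have y: "\<forall>a\<in>set y. 2 < a"
  proof (cases y)
    case (Cons a z)
    then have "\<not> a \<le> 2" by (simp add: y_def dropWhile_eq_Cons_conv)
    then show ?thesis using sy Cons by auto
  qed simp
  define t where "t = map (\<lambda>a. a - 2) y"
  have t: "map (\<lambda>a. a + 2) t = y" unfolding t_def map_map using y by (intro map_idI) auto
  have "is_rgf t" unfolding t_def using is_rgf_appendD2[of v y 2] w vy v y by simp
  moreover have "is_rgf v" using is_rgf_appendD1[of v y] w vy by simp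
  moreover have "sorted t"
    unfolding t_def sorted_wrt_map using y by (auto intro!: sorted_wrt_mono_rel[OF _ sy])
  \<comment> \<open>A letter above 2 forces 2 to occur in \<open>w\<close>, and \<open>y\<close> has
    only letters above 2.\<close>
  moreover have "2 \<in> set v" if "t \<noteq> []"
  proof -
    have "y \<noteq> []" using that by (simp add: t_def)
    then obtain a where "a \<in> set y" using last_in_set by blast
    then have "a \<in> set w" "2 \<le> a" using vy y by auto
    then have "2 \<in> set w" using is_rgf_downward[OF w(2), of a 2] by simp
    then have "2 \<in> set v \<union> set y" unfolding vy[symmetric] by simp
    then show ?thesis using y by auto
  qed
  moreover have "set v \<subseteq> {1, 2}"
  proof
    fix a assume "a \<in> set v"
    then have "1 \<le> a" "a \<le> 2" using v is_rgf_pos[OF \<open>is_rgf v\<close>] by auto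
    then show "a \<in> {1, 2}" by auto
  qed
  moreover have "length v + length t = n" unfolding t_def using vy w by auto
  ultimately have "(v, t) \<in> decomps n" by (simp add: decomps_def)
  moreover have "w = binary_first (v, t)" using t vy by (simp add: binary_first_def)
  ultimately show "w \<in> binary_first ` decomps n" by blast
qed

lemma card_binary_last:
  assumes "(v, t) \<in> decomps n"
  shows "card (set (binary_last (v, t))) = card (set t) + card (set v)"
proof -
  let ?s = "\<lambda>a. a + card (set t)"
  have rgf: "is_rgf t" "is_rgf v" using assms by (simp_all add: decomps_def)
  have "b \<noteq> a + card (set t)" if "b \<in> set t" "a \<in> set v" for a b
    using that is_rgf_mem_iff[OF rgf(1), of b] is_rgf_pos[OF rgf(2), of a] by linarith
  then have "set t \<inter> ?s ` set v = {}" by blast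
  moreover have "card (?s ` set v) = card (set v)" by (rule card_image) simp
  ultimately show ?thesis by (simp add: binary_last_def card_Un_disjoint)
qed

text \<open>To decompose a word with largest letter \<open>m\<close>, cut it before its first letter
  that is at least \<open>m - 1\<close>. Every inversion ends in \<open>m - 1\<close>, so no smaller
  letter follows the cut.\<close>

lemma binary_last_image:
  "binary_last ` decomps n =
    {w. length w = n \<and> is_rgf w \<and>
      sorted_wrt (\<lambda>x y. x \<le> y \<or> x = card (set w) \<and> Suc y = card (set w)) w}"
proof (intro set_eqI iffI)
  fix w assume "w \<in> binary_last ` decomps n"
  then obtain v t where vt: "(v, t) \<in> decomps n" and w: "w = t @ map (\<lambda>a. a + card (set t)) v"
    by (auto simp: binary_last_def)
  note vt' = vt[unfolded decomps_def, simplified]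
  let ?R = "\<lambda>x y. x \<le> y \<or> x = card (set w) \<and> Suc y = card (set w)"
  have m: "card (set w) = card (set t) + card (set v)"
    using card_binary_last[OF vt] w by (simp add: binary_last_def)
  have "is_rgf w" using is_rgf_append_shift[of t v] vt' w by simp
  moreover have "sorted_wrt ?R t" using vt' by (auto intro: sorted_wrt_mono_rel[of t "(\<le>)"])
  moreover have "sorted_wrt ?R (map (\<lambda>a. a + card (set t)) v)"
    unfolding sorted_wrt_map unfolding sorted_wrt_iff_nth_less
  proof (intro allI impI)
    fix i j assume ij: "i < j" "j < length v"
    have mem: "1 \<le> v ! i \<and> v ! i \<le> card (set v)" "1 \<le> v ! j \<and> v ! j \<le> card (set v)"
      using is_rgf_mem_iff[of v] vt' ij by (metis less_trans nth_mem, metis nth_mem)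
    have "card (set v) \<le> card {1, 2 :: nat}" using vt' by (intro card_mono) auto
    then have "card (set v) \<le> 2" by simp
    then show "v ! i + card (set t) \<le> v ! j + card (set t) \<or>
        v ! i + card (set t) = card (set w) \<and> Suc (v ! j + card (set t)) = card (set w)"
      using mem unfolding m by linarith
  qed
  moreover have "\<forall>x\<in>set t. \<forall>y\<in>set v. x \<le> y + card (set t)"
    using vt' is_rgf_mem_iff[of t] by (meson trans_le_add2)
  ultimately show "w \<in> {w. length w = n \<and> is_rgf w \<and> sorted_wrt
      (\<lambda>x y. x \<le> y \<or> x = card (set w) \<and> Suc y = card (set w)) w}"
    using vt' unfolding mem_Collect_eq by (subst (4) w) (simp add: sorted_wrt_append w)
next
  fix w assume "w \<in> {w. length w = n \<and> is_rgf w \<and> sorted_wrt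
      (\<lambda>x y. x \<le> y \<or> x = card (set w) \<and> Suc y = card (set w)) w}"
  moreover define m where "m = card (set w)"
  ultimately have w: "length w = n" "is_rgf w" "sorted_wrt (\<lambda>x y. x \<le> y \<or> x = m \<and> Suc y = m) w"
    by auto
  have sw: "set w = {1..m}" using set_is_rgf[OF w(2)] by (simp add: m_def)
  \<comment> \<open>For \<open>m \<le> 2\<close> the part \<open>t\<close> is empty and the
    truncated \<open>m - 2\<close> is 0, so \<open>v\<close> is the whole word.\<close>
  define t y where "t = takeWhile (\<lambda>a. a < m - 1) w" and "y = dropWhile (\<lambda>a. a < m - 1) w"
  have ty: "t @ y = w" by (simp add: t_def y_def)
  have t: "\<forall>a\<in>set t. a < m - 1" unfolding t_def using set_takeWhileD by fastforce
  have s: "sorted_wrt (\<lambda>x y. x \<le> y \<or> x = m \<and> Suc y = m) t"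
      "sorted_wrt (\<lambda>x y. x \<le> y \<or> x = m \<and> Suc y = m) y"
    using w(3) unfolding ty[symmetric] sorted_wrt_append by blast+
  have y1: "\<forall>a\<in>set y. m - 1 \<le> a"
  proof (cases y)
    case (Cons a z)
    then have "\<not> a < m - 1" by (simp add: y_def dropWhile_eq_Cons_conv)
    then show ?thesis using s(2) Cons by auto
  qed simp
  have y2: "\<forall>a\<in>set y. 1 \<le> a \<and> a \<le> m"
    using sw unfolding ty[symmetric] by auto
  have y: "\<forall>a\<in>set y. m - 2 < a" using y1 y2 by fastforce
  have "is_rgf t" using is_rgf_appendD1[of t y] w ty by simp
  have "set t = {1..m - 2}"
  proof (intro set_eqI iffI)
    fix a assume "a \<in> set t"
    then show "a \<in> {1..m - 2}" using is_rgf_pos[OF \<open>is_rgf t\<close>] t by fastforce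
  next
    fix a assume a: "a \<in> {1..m - 2}"
    then have "a \<in> set t \<union> set y" using sw unfolding ty[symmetric] by auto
    then show "a \<in> set t" using a y by auto
  qed
  then have r: "card (set t) = m - 2" by simp
  define v where "v = map (\<lambda>a. a - (m - 2)) y"
  have v: "map (\<lambda>a. a + (m - 2)) v = y" unfolding v_def map_map using y by (intro map_idI) auto
  have "is_rgf v"
    unfolding v_def using is_rgf_appendD2[of t y "m - 2"] w ty t y by fastforce
  moreover note \<open>is_rgf t\<close>
  moreover have "sorted t"
    using t by (intro sorted_wrt_mono_rel[OF _ s(1)]) auto
  moreover have "2 \<in> set v" if "t \<noteq> []"
  proof -
    have "0 < card (set t)" using that by (simp add: card_gt_0_iff)
    then have "2 < m" unfolding r by simp
    then have "m \<in> set t \<union> set y" using sw unfolding ty[symmetric] by auto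
    then have "m \<in> set y" using t by auto
    then have "m - (m - 2) \<in> set v" unfolding v_def by simp
    then show ?thesis using \<open>2 < m\<close> by simp
  qed
  moreover have "set v \<subseteq> {1, 2}"
  proof
    fix a assume "a \<in> set v"
    then obtain b where "b \<in> set y" "a = b - (m - 2)" by (auto simp: v_def)
    then have "1 \<le> a" "a \<le> 2" using y y2 by fastforce+
    then show "a \<in> {1, 2}" by auto
  qed
  moreover have "length v + length t = n" unfolding v_def using ty w by auto
  ultimately have "(v, t) \<in> decomps n" by (simp add: decomps_def)
  moreover have "w = binary_last (v, t)" using v ty r by (simp add: binary_last_def)
  ultimately show "w \<in> binary_last ` decomps n" by blast
qed

text \<open>The two parts use letters on different sides of the threshold 2, so filtering recovers
  them.\<close>

lemma inj_on_binary_first: "inj_on binary_first (decomps n)"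
proof (rule inj_on_inverseI)
  fix x assume x: "x \<in> decomps n"
  obtain v t where [simp]: "x = (v, t)" by (cases x)
  have "\<forall>a\<in>set v. a \<le> 2" "\<forall>a\<in>set t. 0 < a"
    using x is_rgf_pos[of t] by (fastforce simp: decomps_def)+
  then have "filter (\<lambda>a. a \<le> 2) (binary_first x) = v"
      "filter (\<lambda>a. 2 < a) (binary_first x) = map (\<lambda>a. a + 2) t"
    by (auto simp: binary_first_def filter_map o_def filter_empty_conv intro!: filter_True)
  then show "(\<lambda>w. (filter (\<lambda>a. a \<le> 2) w, map (\<lambda>a. a - 2) (filter (\<lambda>a. 2 < a) w))) (binary_first x) = x"
    by (simp add: o_def)
qed

text \<open>Here the threshold \<open>r\<close> must be read off the word itself, as its number of
  letters minus 2.\<close>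

lemma inj_on_binary_last: "inj_on binary_last (decomps n)"
proof (rule inj_on_inverseI)
  fix x assume x: "x \<in> decomps n"
  obtain v t where [simp]: "x = (v, t)" by (cases x)
  have vt: "(v, t) \<in> decomps n" using x by simp
  define r where "r = card (set t)"
  have "card (set v) \<le> card {1, 2 :: nat}"
    using vt by (intro card_mono) (auto simp: decomps_def)
  moreover have "card (set v) = 2" if "t \<noteq> []" using decomps_set[OF vt that] by simp
  \<comment> \<open>If \<open>t\<close> is empty, \<open>v\<close> may have fewer than two letters,
    and truncated subtraction still gives \<open>r = 0\<close>.\<close>
  ultimately have r: "card (set (binary_last x)) - 2 = r"
    using card_binary_last[OF vt] by (cases "t = []") (auto simp: r_def)
  have "set t = {1..r}" using vt set_is_rgf by (simp add: decomps_def r_def)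
  then have "\<forall>a\<in>set t. a \<le> r" "\<forall>a\<in>set v. 0 < a"
    using vt is_rgf_pos[of v] by (fastforce simp: decomps_def)+
  then have "filter (\<lambda>a. a \<le> r) (binary_last x) = t"
      "filter (\<lambda>a. r < a) (binary_last x) = map (\<lambda>a. a + r) v"
    by (auto simp: binary_last_def filter_map o_def r_def[symmetric] filter_empty_conv intro!: filter_True)
  then show "(\<lambda>w. let r = card (set w) - 2 in
      (map (\<lambda>a. a - r) (filter (\<lambda>a. r < a) w), filter (\<lambda>a. a \<le> r) w)) (binary_last x) = x"
    unfolding Let_def r by (simp add: o_def)
qed

subsection \<open>The statistics of concatenated words\<close>

lemma ls_alt: "ls w = (\<Sum>i<length w. card {c \<in> set (take i w). c < w ! i})"
  unfolding ls_def ls_at_def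
  by (intro sum.cong arg_cong[of _ _ card] refl) (force simp: in_set_conv_nth)

lemma lb_alt: "lb w = (\<Sum>i<length w. card {c \<in> set (take i w). w ! i < c})"
  unfolding lb_def lb_at_def
  by (intro sum.cong arg_cong[of _ _ card] refl) (force simp: in_set_conv_nth)

lemma Collect_nth_after:
  "{w ! j |j. i < j \<and> j < length w \<and> P (w ! j)} = {c \<in> set (drop (Suc i) w). P c}"
proof (intro set_eqI iffI)
  fix c assume "c \<in> {w ! j |j. i < j \<and> j < length w \<and> P (w ! j)}"
  then obtain j where "i < j" "j < length w" "P c" "c = w ! j" by auto
  moreover from this have "drop (Suc i) w ! (j - Suc i) = c" by simp
  ultimately show "c \<in> {c \<in> set (drop (Suc i) w). P c}"
    using nth_mem[of "j - Suc i" "drop (Suc i) w"] by simp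
next
  fix c assume "c \<in> {c \<in> set (drop (Suc i) w). P c}"
  then obtain k where "k < length w - Suc i" "P c" "c = w ! (Suc i + k)"
    by (auto simp: in_set_conv_nth)
  then show "c \<in> {w ! j |j. i < j \<and> j < length w \<and> P (w ! j)}"
    by (intro CollectI exI[of _ "Suc i + k"]) simp
qed

lemma rs_alt: "rs w = (\<Sum>i<length w. card {c \<in> set (drop (Suc i) w). c < w ! i})"
  unfolding rs_def rs_at_def by (intro sum.cong refl arg_cong[of _ _ card] Collect_nth_after)

lemma rb_alt: "rb w = (\<Sum>i<length w. card {c \<in> set (drop (Suc i) w). w ! i < c})"
  unfolding rb_def rb_at_def by (intro sum.cong refl arg_cong[of _ _ card] Collect_nth_after)

lemma stat_Nil [simp]: "ls [] = 0" "lb [] = 0" "rs [] = 0" "rb [] = 0"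
  by (simp_all add: ls_def lb_def rs_def rb_def)

text \<open>\<open>rs\<close> and \<open>rb\<close> look to the right, so adding a letter in front
  leaves the other contributions unchanged; for \<open>ls\<close> and \<open>lb\<close> the same
  holds when a letter is added at the end. This decides the direction of each induction
  below.\<close>

lemma rs_Cons: "rs (a # w) = card {c \<in> set w. c < a} + rs w"
  unfolding rs_alt by (simp add: sum.lessThan_Suc_shift del: sum.lessThan_Suc)

lemma rb_Cons: "rb (a # w) = card {c \<in> set w. a < c} + rb w"
  unfolding rb_alt by (simp add: sum.lessThan_Suc_shift del: sum.lessThan_Suc)

lemma ls_snoc: "ls (w @ [a]) = ls w + card {c \<in> set w. c < a}"
  unfolding ls_alt by (simp add: nth_append)

lemma lb_snoc: "lb (w @ [a]) = lb w + card {c \<in> set w. a < c}"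
  unfolding lb_alt by (simp add: nth_append)

lemma card_Collect_image:
  assumes "inj_on f A"
  shows "card {c \<in> f ` A. P c} = card {c \<in> A. P (f c)}"
proof -
  have "{c \<in> f ` A. P c} = f ` {c \<in> A. P (f c)}" by auto
  moreover have "inj_on f {c \<in> A. P (f c)}" using assms by (rule inj_on_subset) auto
  ultimately show ?thesis by (simp add: card_image)
qed

lemma stat_shift [simp]:
  "rs (map (\<lambda>a. a + k) w) = rs w" "rb (map (\<lambda>a. a + k) w) = rb w"
  "ls (map (\<lambda>a. a + k) w) = ls w" "lb (map (\<lambda>a. a + k) w) = lb w"
proof -
  show "rs (map (\<lambda>a. a + k) w) = rs w"
    by (induction w) (simp_all add: rs_Cons card_Collect_image)
  show "rb (map (\<lambda>a. a + k) w) = rb w"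
    by (induction w) (simp_all add: rb_Cons card_Collect_image)
  show "ls (map (\<lambda>a. a + k) w) = ls w"
    by (induction w rule: rev_induct) (simp_all add: ls_snoc card_Collect_image)
  show "lb (map (\<lambda>a. a + k) w) = lb w"
    by (induction w rule: rev_induct) (simp_all add: lb_snoc card_Collect_image)
qed

text \<open>Reversal exchanges left and right, and complementation exchanges smaller and larger. The
  bound \<open>k\<close> keeps truncated subtraction order-reversing.\<close>

lemma ls_reverse_complement:
  assumes "\<forall>a\<in>set w. a \<le> k"
  shows "ls (map (\<lambda>a. k - a) (rev w)) = rb w"
  using assms
proof (induction w)
  case (Cons a w)
  have "inj_on (\<lambda>a. k - a) (set w)"
    using Cons.prems by (intro inj_onI) (metis diff_diff_cancel list.set_intros(2))
  then have "card {c \<in> (\<lambda>a. k - a) ` set w. c < k - a} = card {c \<in> set w. k - c < k - a}"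
    by (rule card_Collect_image)
  moreover have "k - c < k - a \<longleftrightarrow> a < c" if "c \<in> set w" for c
  proof -
    have "c \<le> k" "a \<le> k" using Cons.prems that by auto
    then show ?thesis by arith
  qed
  then have "{c \<in> set w. k - c < k - a} = {c \<in> set w. a < c}"
    by blast
  ultimately show ?case using Cons by (simp add: ls_snoc rb_Cons)
qed simp

text \<open>No inversion crosses the cut, so \<open>rs\<close> and \<open>lb\<close> add up. Each
  position of \<open>x\<close> sees all distinct letters of \<open>y\<close> as larger letters to
  its right, and each position of \<open>y\<close> sees those of \<open>x\<close> as smaller letters
  to its left; this gives the products.\<close>

lemma stat_append:
  assumes "\<forall>a\<in>set x. \<forall>b\<in>set y. a < b"
  shows "rs (x @ y) = rs x + rs y"
    and "rb (x @ y) = rb x + rb y + length x * card (set y)"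
    and "ls (x @ y) = ls x + ls y + card (set x) * length y"
    and "lb (x @ y) = lb x + lb y"
proof -
  show "rs (x @ y) = rs x + rs y"
    using assms
  proof (induction x)
    case (Cons a x)
    have "{c \<in> set (x @ y). c < a} = {c \<in> set x. c < a}"
      using Cons.prems by fastforce
    then show ?case using Cons by (simp add: rs_Cons)
  qed simp
  show "rb (x @ y) = rb x + rb y + length x * card (set y)"
    using assms
  proof (induction x)
    case (Cons a x)
    have "{c \<in> set (x @ y). a < c} = {c \<in> set x. a < c} \<union> set y"
      using Cons.prems by auto
    moreover have "{c \<in> set x. a < c} \<inter> set y = {}"
      using Cons.prems by fastforce
    ultimately have "card {c \<in> set (x @ y). a < c} = card {c \<in> set x. a < c} + card (set y)"
      by (simp add: card_Un_disjoint)
    then show ?case using Cons by (simp add: rb_Cons)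
  qed simp
  show "ls (x @ y) = ls x + ls y + card (set x) * length y"
    using assms
  proof (induction y rule: rev_induct)
    case (snoc b y)
    have "{c \<in> set (x @ y). c < b} = set x \<union> {c \<in> set y. c < b}"
      using snoc.prems by auto
    moreover have "set x \<inter> {c \<in> set y. c < b} = {}"
      using snoc.prems by fastforce
    ultimately have "card {c \<in> set (x @ y). c < b} = card (set x) + card {c \<in> set y. c < b}"
      by (simp add: card_Un_disjoint)
    then show ?case
      using snoc ls_snoc[of "x @ y" b] by (simp add: ls_snoc)
  qed simp
  show "lb (x @ y) = lb x + lb y"
    using assms
  proof (induction y rule: rev_induct)
    case (snoc b y)
    have "{c \<in> set (x @ y). b < c} = {c \<in> set y. b < c}"
      using snoc.prems by fastforce
    then show ?case
      using snoc lb_snoc[of "x @ y" b] by (simp add: lb_snoc)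
  qed simp
qed

lemma rs_sorted: "sorted w \<Longrightarrow> rs w = 0"
proof (induction w)
  case (Cons a w)
  then have "{c \<in> set w. c < a} = {}" by auto
  then show ?case using Cons by (simp add: rs_Cons)
qed simp

lemma lb_sorted: "sorted w \<Longrightarrow> lb w = 0"
proof (induction w rule: rev_induct)
  case (snoc a w)
  then have "{c \<in> set w. a < c} = {}" by (auto simp: sorted_append)
  then show ?case using snoc by (simp add: lb_snoc sorted_append)
qed simp

lemma stat_binary_first:
  assumes "(v, t) \<in> decomps n"
  shows "lb (binary_first (v, t)) = lb v" and "rs (binary_first (v, t)) = rs v"
    and "ls (binary_first (v, t)) = ls v + ls t + card (set v) * length t"
    and "rb (binary_first (v, t)) = rb v + rb t + length v * card (set t)"
proof -
  have vt: "set v \<subseteq> {1, 2}" "is_rgf t" "sorted t" using assms by (simp_all add: decomps_def)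
  have "a < b + 2" if "a \<in> set v" "b \<in> set t" for a b
  proof -
    have "1 \<le> b" using is_rgf_pos[OF vt(2) that(2)] .
    moreover have "a \<le> 2" using vt(1) that(1) by auto
    ultimately show ?thesis by simp
  qed
  then have *: "\<forall>a\<in>set v. \<forall>b\<in>set (map (\<lambda>a. a + 2) t). a < b" by simp
  have c: "card ((\<lambda>a. a + 2) ` set t) = card (set t)" by (rule card_image) (simp add: inj_on_def)
  show "lb (binary_first (v, t)) = lb v" and "rs (binary_first (v, t)) = rs v"
    and "ls (binary_first (v, t)) = ls v + ls t + card (set v) * length t"
    and "rb (binary_first (v, t)) = rb v + rb t + length v * card (set t)"
    using stat_append[OF *] c lb_sorted[OF vt(3)] rs_sorted[OF vt(3)]
    by (simp_all add: binary_first_def del: add_2_eq_Suc')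
qed

text \<open>Compared with \<open>stat_binary_first\<close>, the cross terms of \<open>ls\<close> and
  \<open>rb\<close> have changed places. Therefore \<open>ls\<close> on one family is matched with
  \<open>rb\<close> on the other.\<close>

lemma stat_binary_last:
  assumes "(v, t) \<in> decomps n"
  shows "lb (binary_last (v, t)) = lb v" and "rs (binary_last (v, t)) = rs v"
    and "ls (binary_last (v, t)) = ls v + ls t + length v * card (set t)"
    and "rb (binary_last (v, t)) = rb v + rb t + card (set v) * length t"
proof -
  have vt: "is_rgf v" "is_rgf t" "sorted t" using assms by (simp_all add: decomps_def)
  let ?s = "\<lambda>a. a + card (set t)"
  have "b < a + card (set t)" if "a \<in> set v" "b \<in> set t" for a b
    using is_rgf_pos[OF vt(1) that(1)] is_rgf_mem_iff[OF vt(2), of b] that(2) by simp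
  then have *: "\<forall>b\<in>set t. \<forall>a\<in>set (map ?s v). b < a" by simp
  have c: "card (?s ` set v) = card (set v)" by (rule card_image) simp
  show "lb (binary_last (v, t)) = lb v" and "rs (binary_last (v, t)) = rs v"
    and "ls (binary_last (v, t)) = ls v + ls t + length v * card (set t)"
    and "rb (binary_last (v, t)) = rb v + rb t + card (set v) * length t"
    using stat_append[OF *] c lb_sorted[OF vt(3)] rs_sorted[OF vt(3)]
    by (simp_all add: binary_last_def)
qed

subsection \<open>Involutions on the decompositions\<close>

fun flip_before :: "nat \<Rightarrow> nat list \<Rightarrow> nat list" where
  "flip_before c [] = []"
| "flip_before c (a # w) = (if c \<in> set w then 3 - a else a) # flip_before c w"

lemma length_flip_before [simp]: "length (flip_before c w) = length w"
  by (induction w) auto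

lemma flip_before_binary: "set w \<subseteq> {1, 2} \<Longrightarrow> set (flip_before c w) \<subseteq> {1, 2}"
  by (induction w) auto

text \<open>The last \<open>c\<close> has no \<open>c\<close> after it and is kept, as is everything
  after it. So the flipped region is the same after a flip, which makes flipping an
  involution.\<close>

lemma mem_flip_before: "c \<in> set (flip_before c w) \<longleftrightarrow> c \<in> set w"
  by (induction w) auto

lemma flip_before_idem: "set w \<subseteq> {1, 2} \<Longrightarrow> flip_before c (flip_before c w) = w"
  by (induction w) (auto simp: mem_flip_before)

text \<open>On two letters \<open>rs\<close> counts the 2s that precede some 1. These are exactly
  the letters that the flip turns into 1; the last 1 is kept and gives the extra summand.\<close>

lemma count_flip_before_1:
  "set w \<subseteq> {1, 2} \<Longrightarrow> count_list (flip_before 1 w) 1 = of_bool (1 \<in> set w) + rs w"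
proof (induction w)
  case (Cons a w)
  have "{c \<in> set w. c < a} = (if a = 2 \<and> 1 \<in> set w then {1} else {})"
    using Cons.prems by auto
  moreover have "count_list (flip_before 1 w) 1 = 0" if "1 \<notin> set w"
    using that mem_flip_before[of 1 w] by (simp add: count_list_0_iff)
  ultimately show ?case using Cons by (auto simp: rs_Cons)
qed simp

lemma count_flip_before_2:
  "set w \<subseteq> {1, 2} \<Longrightarrow> count_list (flip_before 2 w) 2 = of_bool (2 \<in> set w) + rb w"
proof (induction w)
  case (Cons a w)
  have "{c \<in> set w. a < c} = (if a = 1 \<and> 2 \<in> set w then {2} else {})"
    using Cons.prems by auto
  moreover have "count_list (flip_before 2 w) 2 = 0" if "2 \<notin> set w"
    using that mem_flip_before[of 2 w] by (simp add: count_list_0_iff)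
  ultimately show ?case using Cons by (auto simp: rb_Cons)
qed simp

text \<open>Distinct values are counted, so after an initial 2 every 1 contributes exactly
  one.\<close>

lemma lb_Cons_2: "set w \<subseteq> {1, 2} \<Longrightarrow> lb (2 # w) = count_list w 1"
proof (induction w rule: rev_induct)
  case Nil
  show ?case using lb_snoc[of "[]" 2] by simp
next
  case (snoc b w)
  have "{c \<in> set (2 # w). b < c} = (if b = 1 then {2} else {})"
    using snoc.prems by auto
  then show ?case using snoc lb_snoc[of "2 # w" b] by simp
qed

lemma ls_Cons_1: "set w \<subseteq> {1, 2} \<Longrightarrow> ls (1 # w) = count_list w 2"
proof (induction w rule: rev_induct)
  case Nil
  show ?case using ls_snoc[of "[]" 1] by simp
next
  case (snoc b w)
  have "{c \<in> set (1 # w). c < b} = (if b = 2 then {1} else {})"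
    using snoc.prems by auto
  then show ?case using snoc ls_snoc[of "1 # w" b] by simp
qed

lemma lb_Cons_1: "set w \<subseteq> {1, 2} \<Longrightarrow> lb (1 # w) = lb w"
proof (induction w rule: rev_induct)
  case Nil
  show ?case using lb_snoc[of "[]" 1] by simp
next
  case (snoc b w)
  have "{c \<in> set (1 # w). b < c} = {c \<in> set w. b < c}"
    using snoc.prems by auto
  then show ?case using snoc lb_snoc[of "1 # w" b] by (simp add: lb_snoc)
qed

text \<open>The leading 1s and the first 2 stay; the flip then acts up to the last 1.\<close>

fun swap_lb_rs :: "nat list \<Rightarrow> nat list" where
  "swap_lb_rs [] = []"
| "swap_lb_rs (a # w) = a # (if a = 1 then swap_lb_rs w else flip_before 1 w)"

fun swap_ls_rb :: "nat list \<Rightarrow> nat list" where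
  "swap_ls_rb [] = []"
| "swap_ls_rb (a # w) = a # flip_before 2 w"

text \<open>Leading 1s contribute to neither statistic. From the first 2 on, \<open>lb\<close> after
  the flip is the number of 1s in the flipped tail, which \<open>count_flip_before_1\<close>
  identifies with \<open>rs\<close> before it.\<close>

lemma lb_swap: "set v \<subseteq> {1, 2} \<Longrightarrow> lb (swap_lb_rs v) = rs v"
proof (induction v)
  case (Cons a v)
  have bin: "set v \<subseteq> {1, 2}" using Cons.prems by simp
  show ?case
  proof (cases "a = 1")
    case True
    have "set (swap_lb_rs v) \<subseteq> {1, 2}"
      using bin by (induction v) (use flip_before_binary in auto)
    then have "lb (swap_lb_rs (a # v)) = rs v"
      using True Cons.IH[OF bin] lb_Cons_1 by simp
    moreover have "{c \<in> set v. c < a} = {}" using True bin by auto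
    ultimately show ?thesis by (simp add: rs_Cons)
  next
    case False
    then have "a = 2" using Cons.prems by simp
    moreover have "{c \<in> set v. c < 2} = (if 1 \<in> set v then {1} else {})"
      using bin by auto
    ultimately show ?thesis
      using lb_Cons_2[OF flip_before_binary[OF bin]] count_flip_before_1[OF bin]
      by (auto simp: rs_Cons)
  qed
qed simp

lemma is_rgf_binary_iff:
  assumes "set v \<subseteq> {1, 2}"
  shows "is_rgf v \<longleftrightarrow> v = [] \<or> hd v = 1"
proof (cases v)
  case (Cons a u)
  have "is_rgf v" if "a = 1"
    unfolding is_rgf_def
  proof (intro allI impI conjI subsetI)
    fix i assume i: "i < length v"
    have vi: "v ! i = 1 \<or> v ! i = 2" using assms nth_mem[OF i] by auto
    then show "1 \<le> v ! i" by auto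
    fix c assume "c \<in> {1..<v ! i}"
    then have "c = 1" "v ! i = 2" using vi by auto
    moreover from this have "i \<noteq> 0" using Cons that by (cases i) auto
    ultimately show "c \<in> set (take i v)" using Cons that by (cases i) auto
  qed
  moreover have "a = 1" if "is_rgf v"
  proof (rule ccontr)
    assume "a \<noteq> 1"
    then have "a = 2" using assms Cons by simp
    moreover have "{1..<v ! 0} \<subseteq> set (take 0 v)"
      using that Cons unfolding is_rgf_def by blast
    ultimately show False using Cons by auto
  qed
  ultimately show ?thesis using Cons by auto
qed (simp add: is_rgf_def)

text \<open>With an initial 1, \<open>ls\<close> after the flip is the number of 2s in the flipped
  tail. By \<open>count_flip_before_2\<close> this is \<open>rb\<close> of the tail, plus one if 2
  occurs there, the contribution of the initial 1.\<close>

lemma ls_swap: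
  assumes "set v \<subseteq> {1, 2}" "is_rgf v"
  shows "ls (swap_ls_rb v) = rb v"
proof (cases v)
  case (Cons a u)
  have u: "set u \<subseteq> {1, 2}" using assms(1) Cons by simp
  have "a = 1" using assms Cons by (simp add: is_rgf_binary_iff)
  moreover have "{c \<in> set u. 1 < c} = (if 2 \<in> set u then {2} else {})" using u by auto
  ultimately show ?thesis
    using Cons ls_Cons_1[OF flip_before_binary[OF u]] count_flip_before_2[OF u]
    by (auto simp: rb_Cons)
qed simp

text \<open>Preserving length and letter set keeps a pair inside \<open>decomps n\<close> and fixes
  the cross terms of \<open>ls\<close> and \<open>rb\<close>.\<close>

definition binary_involution :: "(nat list \<Rightarrow> nat list) \<Rightarrow> bool" where
  "binary_involution f \<longleftrightarrow> (\<forall>v. set v \<subseteq> {1, 2} \<and> is_rgf v \<longrightarrow>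
     length (f v) = length v \<and> set (f v) = set v \<and> is_rgf (f v) \<and> f (f v) = v)"

lemma binary_involutionI:
  assumes "\<And>v. set v \<subseteq> {1, 2} \<Longrightarrow> length (f v) = length v"
    and bin: "\<And>v. set v \<subseteq> {1, 2} \<Longrightarrow> set (f v) \<subseteq> {1, 2}"
    and two: "\<And>v. set v \<subseteq> {1, 2} \<Longrightarrow> hd v = 1 \<Longrightarrow> 2 \<in> set (f v) \<longleftrightarrow> 2 \<in> set v"
    and hd: "\<And>v. v \<noteq> [] \<Longrightarrow> hd (f v) = hd v"
    and "\<And>v. set v \<subseteq> {1, 2} \<Longrightarrow> f (f v) = v"
  shows "binary_involution f"
  unfolding binary_involution_def
proof (intro allI impI)
  fix v assume v: "set v \<subseteq> {1, 2} \<and> is_rgf v"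
  have len: "length (f v) = length v" using v assms(1) by blast
  have rgf: "is_rgf (f v)"
    using v len hd[of v] bin[of v] by (cases "v = []") (auto simp: is_rgf_binary_iff)
  have "set (f v) = set v"
  proof (cases "v = []")
    case False
    then have h: "hd v = 1" using v is_rgf_binary_iff by blast
    have "1 \<in> set v" using h False hd_in_set[of v] by metis
    moreover have "f v \<noteq> []" using len False by auto
    then have "1 \<in> set (f v)" using h False hd[of v] hd_in_set[of "f v"] by metis
    ultimately show ?thesis using two[of v] h bin[of v] v by blast
  qed (use len in simp)
  then show "length (f v) = length v \<and> set (f v) = set v \<and> is_rgf (f v) \<and> f (f v) = v"
    using len rgf assms(5) v by blast
qed

lemma binary_involution_swap_lb_rs: "binary_involution swap_lb_rs"
proof (rule binary_involutionI)
  fix v :: "nat list" assume bin: "set v \<subseteq> {1, 2}"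
  show "length (swap_lb_rs v) = length v" by (induction v) auto
  show "set (swap_lb_rs v) \<subseteq> {1, 2}"
    using bin by (induction v) (use flip_before_binary in auto)
  show "swap_lb_rs (swap_lb_rs v) = v"
    using bin by (induction v) (auto simp: flip_before_idem)
  show "2 \<in> set (swap_lb_rs v) \<longleftrightarrow> 2 \<in> set v"
    using bin by (induction v) auto
next
  fix v :: "nat list" assume "v \<noteq> []"
  then show "hd (swap_lb_rs v) = hd v" by (cases v) auto
qed

lemma binary_involution_swap_ls_rb: "binary_involution swap_ls_rb"
proof (rule binary_involutionI)
  fix v :: "nat list" assume bin: "set v \<subseteq> {1, 2}"
  show "length (swap_ls_rb v) = length v" by (cases v) auto
  show "set (swap_ls_rb v) \<subseteq> {1, 2}"
    using bin by (cases v) (use flip_before_binary in auto)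
  show "swap_ls_rb (swap_ls_rb v) = v"
    using bin by (cases v) (auto simp: flip_before_idem)
  show "2 \<in> set (swap_ls_rb v) \<longleftrightarrow> 2 \<in> set v"
    by (cases v) (auto simp: mem_flip_before)
next
  fix v :: "nat list" assume "v \<noteq> []"
  then show "hd (swap_ls_rb v) = hd v" by (cases v) auto
qed

section \<open>Reversing and complementing the weakly increasing part\<close>

lemma is_rgf_sorted:
  assumes "sorted t" "set t = {1..k}"
  shows "is_rgf t"
  unfolding is_rgf_def
proof (intro allI impI conjI subsetI)
  fix i assume i: "i < length t"
  then have ti: "1 \<le> t ! i" "t ! i \<le> k" using nth_mem[OF i] assms(2) by auto
  then show "1 \<le> t ! i" by simp
  fix c assume c: "c \<in> {1..<t ! i}"
  then have "c \<in> set t" using ti assms(2) by simp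
  then obtain j where j: "j < length t" "t ! j = c" by (auto simp: in_set_conv_nth)
  have "\<not> i \<le> j" using sorted_nth_mono[OF assms(1), of i j] j c by auto
  then show "c \<in> set (take i t)" using i j by (auto simp: in_set_conv_nth intro!: exI[of _ j])
qed

definition reverse_complement :: "nat list \<Rightarrow> nat list" where
  "reverse_complement t = map (\<lambda>a. Suc (card (set t)) - a) (rev t)"

text \<open>The letters form the interval from 1 to \<open>card (set t)\<close>, which the
  reflection maps onto itself. Reversal and reflection each reverse the order, so the result is
  again weakly increasing.\<close>

lemma reverse_complement:
  assumes t: "is_rgf t" "sorted t"
  shows "is_rgf (reverse_complement t)" and "sorted (reverse_complement t)"
    and "set (reverse_complement t) = set t"
    and "reverse_complement (reverse_complement t) = t"
    and "ls (reverse_complement t) = rb t"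
proof -
  let ?m = "card (set t)"
  note mem = is_rgf_mem_iff[OF t(1)]
  have reflect: "Suc ?m - a \<in> set t" "Suc ?m - (Suc ?m - a) = a" "a \<le> Suc ?m" if "a \<in> set t" for a
    using that mem[of a] mem[of "Suc ?m - a"] by linarith+
  show st: "set (reverse_complement t) = set t"
    unfolding reverse_complement_def set_map set_rev
  proof
    show "(\<lambda>a. Suc ?m - a) ` set t \<subseteq> set t" using reflect(1) by blast
    show "set t \<subseteq> (\<lambda>a. Suc ?m - a) ` set t" using reflect(1,2) by (metis image_eqI subsetI)
  qed
  show "sorted (reverse_complement t)"
    using t(2) unfolding reverse_complement_def sorted_wrt_map sorted_wrt_rev
    by (auto intro: sorted_wrt_mono_rel[of t "(\<le>)"])
  then show "is_rgf (reverse_complement t)"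
    by (rule is_rgf_sorted[of _ ?m]) (use st set_is_rgf[OF t(1)] in simp)
  show "reverse_complement (reverse_complement t) = t"
    unfolding reverse_complement_def[of "reverse_complement t"] st
    using reflect(2) by (simp add: reverse_complement_def rev_map o_def map_idI)
  show "ls (reverse_complement t) = rb t"
    unfolding reverse_complement_def using reflect(3) by (intro ls_reverse_complement) blast
qed


text \<open>The involution \<open>h\<close> maps each level set of the first statistic onto that of
  the second, both taken on decompositions; injectivity of \<open>F\<close> and \<open>G\<close>
  carries the cardinalities over to words.\<close>

lemma equidistributed_decomps:
  assumes F: "inj_on F (decomps n)" and G: "inj_on G (decomps n)"
    and h: "\<And>x. x \<in> decomps n \<Longrightarrow> h x \<in> decomps n" "\<And>x. x \<in> decomps n \<Longrightarrow> h (h x) = x"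
    and st: "\<And>x. x \<in> decomps n \<Longrightarrow> st' (G (h x)) = st (F x)"
  shows "equidistributed st (F ` decomps n) st' (G ` decomps n)"
  unfolding equidistributed_def
proof
  fix k :: int
  let ?A = "{x \<in> decomps n. int (st (F x)) = k}" and ?B = "{x \<in> decomps n. int (st' (G x)) = k}"
  have "bij_betw h ?A ?B"
  proof (rule bij_betwI[where g = h])
    have "st (F (h x)) = st' (G x)" if "x \<in> decomps n" for x
      using st[OF h(1)[OF that]] h(2)[OF that] by simp
    then show "h \<in> ?B \<rightarrow> ?A" using h(1) by simp
  qed (simp_all add: h st)
  then have "card ?A = card ?B" by (rule bij_betw_same_card)
  then show "card {w \<in> F ` decomps n. int (st w) = k} = card {w \<in> G ` decomps n. int (st' w) = k}"
    using F G by (simp add: card_Collect_image)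
qed

lemma decomps_swap:
  assumes "binary_involution f" "(v, t) \<in> decomps n"
  shows "(f v, t) \<in> decomps n" "f (f v) = v"
  using assms by (auto simp: decomps_def binary_involution_def)

lemma decomps_reverse_complement:
  assumes "(v, t) \<in> decomps n"
  shows "(v, reverse_complement t) \<in> decomps n"
proof -
  have "length (reverse_complement t) = length t"
    by (simp add: reverse_complement_def)
  then show ?thesis
    using assms reverse_complement[of t] by (auto simp: decomps_def)
qed

theorem theorem8p4:
  fixes n :: nat
  assumes "n \<ge> 1"
  shows "(equidistributed lb (R n pat_14_2_3 pat_1_24_3) rs (R n pat_14_2_3 pat_1_24_3) \<and>
          equidistributed rs (R n pat_14_2_3 pat_1_24_3) lb (R n pat_14_2_3 pat_13_2_4) \<and>
          equidistributed lb (R n pat_14_2_3 pat_13_2_4) rs (R n pat_14_2_3 pat_13_2_4)) \<and>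
         equidistributed ls (R n pat_14_2_3 pat_1_24_3) rb (R n pat_14_2_3 pat_13_2_4) \<and>
         equidistributed rb (R n pat_14_2_3 pat_1_24_3) ls (R n pat_14_2_3 pat_13_2_4)"
proof -
  have R1: "R n pat_14_2_3 pat_1_24_3 = binary_first ` decomps n"
    unfolding binary_first_image R_eq[OF represents_pat(1,2)]
    using avoids_1231_1232_iff by blast
  have R2: "R n pat_14_2_3 pat_13_2_4 = binary_last ` decomps n"
    unfolding binary_last_image R_eq[OF represents_pat(1,3)]
    using avoids_1231_1213_iff by blast
  note inj = inj_on_binary_first[of n] inj_on_binary_last[of n]
  note stats = stat_binary_first[where n = n] stat_binary_last[where n = n]
  \<comment> \<open>For \<open>lb\<close> and \<open>rs\<close>, which see only \<open>v\<close>,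
    the weakly increasing part is left alone. For \<open>ls\<close> and \<open>rb\<close> the map
    \<open>?g\<close> changes both parts.\<close>
  let ?f = "\<lambda>(v, t). (swap_lb_rs v, t)"
  let ?g = "\<lambda>(v, t). (swap_ls_rb v, reverse_complement t)"
  have f: "?f x \<in> decomps n" "?f (?f x) = x" if "x \<in> decomps n" for x
    using that decomps_swap[OF binary_involution_swap_lb_rs] by (auto split: prod.splits)
  have lb_f: "lb (swap_lb_rs v) = rs v" "rs (swap_lb_rs v) = lb v"
    if "(v, t) \<in> decomps n" for v t
    using that decomps_swap[OF binary_involution_swap_lb_rs that] lb_swap[of v]
      lb_swap[of "swap_lb_rs v"] by (auto simp: decomps_def)
  have g: "?g x \<in> decomps n" "?g (?g x) = x" if x: "x \<in> decomps n" for x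
  proof -
    obtain v t where [simp]: "x = (v, t)" by (cases x)
    have vt: "(v, t) \<in> decomps n" using x by simp
    note s = decomps_swap[OF binary_involution_swap_ls_rb vt]
    show "?g x \<in> decomps n"
      using decomps_reverse_complement[OF s(1)] by simp
    have "reverse_complement (reverse_complement t) = t"
      using vt by (intro reverse_complement(4)) (simp_all add: decomps_def)
    then show "?g (?g x) = x" using s(2) by simp
  qed
  \<comment> \<open>The second equation is the first one applied to \<open>swap_ls_rb v\<close>, by
    involutivity. Letter set and length are recorded here and in \<open>g_t\<close> to match the
    cross terms.\<close>
  have g_v: "ls (swap_ls_rb v) = rb v" "rb (swap_ls_rb v) = ls v" "set (swap_ls_rb v) = set v"
      "length (swap_ls_rb v) = length v" if "(v, t) \<in> decomps n" for v t
    using that decomps_swap[OF binary_involution_swap_ls_rb that] ls_swap[of v]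
      ls_swap[of "swap_ls_rb v"] binary_involution_swap_ls_rb
    by (auto simp: decomps_def binary_involution_def)
  have g_t: "ls (reverse_complement t) = rb t" "rb (reverse_complement t) = ls t"
      "set (reverse_complement t) = set t" "length (reverse_complement t) = length t"
    if "(v, t) \<in> decomps n" for v t
    using that reverse_complement[of t] reverse_complement(5)[of "reverse_complement t"]
    by (auto simp: decomps_def reverse_complement_def[of t])
  have "equidistributed lb (binary_first ` decomps n) rs (binary_first ` decomps n)"
    by (rule equidistributed_decomps[OF inj(1,1) f])
      (use f(1) in \<open>auto simp: stats lb_f\<close>)
  moreover have "equidistributed rs (binary_first ` decomps n) lb (binary_last ` decomps n)"
    by (rule equidistributed_decomps[OF inj(1,2) f])
      (use f(1) in \<open>auto simp: stats lb_f\<close>)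
  moreover have "equidistributed lb (binary_last ` decomps n) rs (binary_last ` decomps n)"
    by (rule equidistributed_decomps[OF inj(2,2) f])
      (use f(1) in \<open>auto simp: stats lb_f\<close>)
  moreover have "equidistributed ls (binary_first ` decomps n) rb (binary_last ` decomps n)"
    by (rule equidistributed_decomps[OF inj(1,2) g])
      (use g(1) in \<open>auto simp: stats g_v g_t\<close>)
  moreover have "equidistributed rb (binary_first ` decomps n) ls (binary_last ` decomps n)"
    by (rule equidistributed_decomps[OF inj(1,2) g])
      (use g(1) in \<open>auto simp: stats g_v g_t\<close>)
  ultimately show ?thesis unfolding R1 R2 by blast
qed

end
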